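(* Let $n\in\mathbb N$, $n\ge 1$. For every $1\leq i\leq n$ and $0\leq m\leq n$, the pair $(\mathcal K^n_{i^{+}},\mathcal K^n_{m^{+}})$ has the $S(n)$-finite extension property.
   Context: $\mathcal K^n$ denotes the family of all (nonempty) compact convex subsets of $\mathbb R^n$, equipped with the Hausdorff metric $d_H(A,B)=\max\{\sup_{b\in B}d(b,A),\sup_{a\in A}d(a,B)\}$, where $d$ is the Euclidean metric. For $j\in\{0,\dots,n\}$, $\mathcal K^n_{j^+}=\{K\in\mathcal K^n\mid \dim(K)\geq j\}$ (with the subspace topology), where $\dim(K)$ is the dimension of the smallest affine subspace of $\mathbb R^n$ containing $K$. $S(n)$ denotes the group of all similarities of $\mathbb R^n$, i.e. all maps $g(x)=u+\lambda\sigma(x)$ with $u\in\mathbb R^n$, $\lambda>0$ and $\sigma\in O(n)$ (the orthogonal group), topologized as $\mathbb R^n\times(0,\infty)\times O(n)$. It acts on $\mathcal K^n_{j^+}$ by $gK=\{g(x)\mid x\in K\}$. For a topological group $G$, a $G$-space is a topological space with a continuous action of $G$; $G_x=\{g\in G\mid gx=x\}$ is the stabilizer of $x$ and $G(x)=\{gx\mid g\in G\}$ its orbit. A $G$-map is a continuous function $f$ between $G$-spaces with $f(gx)=gf(x)$ for all $g\in G$ and all $x$. A pair $(X,Y)$ of $G$-spaces has the $G$-finite extension property if for all finite sets $\{x_1,\dots,x_k\}\subset X$ and $\{y_1,\dots,y_k\}\subset Y$ satisfying (1) $G_{x_l}\leq G_{y_l}$ for every $l\in\{1,\dots,k\}$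 and (2) $G(x_l)\cap G(x_j)=\emptyset$ if $l\neq j$, there exists a $G$-map $\psi:X\to Y$ such that $\psi(x_l)=y_l$ for every $l\in\{1,\dots,k\}$. *)

theory Defs
  imports "HOL-Analysis.Analysis" "HOL-Algebra.Group_Action"
begin

section \<open>Topological groups, G-spaces and the finite extension property\<close>

locale topological_group = group G for G (structure) +
  fixes T :: "'a topology"
  assumes topspace_eq: "topspace T = carrier G"
    and continuous_mult: "continuous_map (prod_topology T T) T (\<lambda>(g, h). g \<otimes> h)"
    and continuous_inv: "continuous_map T T (\<lambda>g. inv g)"

text \<open>
  The topological space is \<open>X\<close>, its points are \<open>topspace X\<close>, and \<open>\<phi> g x\<close> is the point \<open>gx\<close>.
  As \<^locale>\<open>group_action\<close> takes values in \<^const>\<open>BijGroup\<close>, each \<open>\<phi> g\<close> has to be extensional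
  outside of \<open>topspace X\<close>.
\<close>

locale G_space = topological_group G T + group_action G "topspace X" \<phi>
  for G (structure) and T :: "'a topology" and X :: "'x topology" and \<phi> :: "'a \<Rightarrow> 'x \<Rightarrow> 'x" +
  assumes continuous_action: "continuous_map (prod_topology T X) X (\<lambda>(g, x). \<phi> g x)"

definition G_map ::
  "('a, 'm) monoid_scheme \<Rightarrow> 'x topology \<Rightarrow> ('a \<Rightarrow> 'x \<Rightarrow> 'x) \<Rightarrow>
   'y topology \<Rightarrow> ('a \<Rightarrow> 'y \<Rightarrow> 'y) \<Rightarrow> ('x \<Rightarrow> 'y) \<Rightarrow> bool"
  where "G_map G X \<phi> Y \<psi> f \<longleftrightarrow>
    continuous_map X Y f \<and> (\<forall>g\<in>carrier G. \<forall>x\<in>topspace X. f (\<phi> g x) = \<psi> g (f x))"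

text \<open>
  The first two conjuncts say that the property is one of pairs of \<open>G\<close>-spaces. The family is
  indexed by \<open>{1..k}\<close>; \<open>k = 0\<close>, where the only claim is that there is a \<open>G\<close>-map, is allowed.
\<close>

definition finite_extension_property ::
  "('a, 'm) monoid_scheme \<Rightarrow> 'a topology \<Rightarrow> 'x topology \<Rightarrow> ('a \<Rightarrow> 'x \<Rightarrow> 'x) \<Rightarrow>
   'y topology \<Rightarrow> ('a \<Rightarrow> 'y \<Rightarrow> 'y) \<Rightarrow> bool"
  where "finite_extension_property G T X \<phi> Y \<psi> \<longleftrightarrow>
    G_space G T X \<phi> \<and> G_space G T Y \<psi> \<and>
    (\<forall>(k::nat) x y.
      (\<forall>l\<in>{1..k}. x l \<in> topspace X \<and> y l \<in> topspace Y) \<longrightarrow>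
      (\<forall>l\<in>{1..k}. stabilizer G \<phi> (x l) \<subseteq> stabilizer G \<psi> (y l)) \<longrightarrow>
      (\<forall>l\<in>{1..k}. \<forall>j\<in>{1..k}. l \<noteq> j \<longrightarrow> orbit G \<phi> (x l) \<inter> orbit G \<phi> (x j) = {}) \<longrightarrow>
      (\<exists>f. G_map G X \<phi> Y \<psi> f \<and> (\<forall>l\<in>{1..k}. f (x l) = y l)))"


section \<open>Spaces of compact convex sets\<close>

text \<open>The value 0 for empty and unbounded sets is a convention, as for \<^const>\<open>infdist\<close>;
  \<^locale>\<open>Metric_space\<close> requires distances to be nonnegative outside of the carrier, too.\<close>

definition hausdorff_dist :: "'a::metric_space set \<Rightarrow> 'a set \<Rightarrow> real"
  where "hausdorff_dist A B =
    (if A = {} \<or> B = {} \<or> \<not> bounded A \<or> \<not> bounded B then 0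
     else max (SUP b\<in>B. infdist b A) (SUP a\<in>A. infdist a B))"

definition compact_convex_sets :: "'a::euclidean_space set set"
  where "compact_convex_sets = {K. K \<noteq> {} \<and> compact K \<and> convex K}"

definition compact_convex_dim_ge :: "nat \<Rightarrow> 'a::euclidean_space set set"
  where "compact_convex_dim_ge j = {K \<in> compact_convex_sets. aff_dim K \<ge> int j}"

definition hausdorff_topology :: "nat \<Rightarrow> 'a::euclidean_space set topology"
  where "hausdorff_topology j =
    subtopology (Metric_space.mtopology compact_convex_sets hausdorff_dist)
      (compact_convex_dim_ge j)"


section \<open>The group of similarities\<close>

definition similarity_params :: "((real^'n) \<times> real \<times> (real^'n^'n)) set"
  where "similarity_params = UNIV \<times> {0<..} \<times> {A. orthogonal_matrix A}"

definition similarity :: "(real^'n) \<times> real \<times> (real^'n^'n) \<Rightarrow> real^'n \<Rightarrow> real^'n"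
  where "similarity = (\<lambda>(u, r, A) x. u + r *\<^sub>R (A *v x))"

definition similarity_group :: "(real^'n \<Rightarrow> real^'n) monoid"
  where "similarity_group = \<lparr>carrier = similarity ` similarity_params, mult = (\<circ>), one = id\<rparr>"

text \<open>The topology for which \<^const>\<open>similarity\<close> is a homeomorphism from
  \<^const>\<open>similarity_params\<close> with the Euclidean (product) topology, see
  \<open>homeomorphic_map_similarity\<close> below.\<close>

definition similarity_topology :: "(real^'n \<Rightarrow> real^'n) topology"
  where "similarity_topology =
    pullback_topology (carrier similarity_group) (inv_into similarity_params similarity)
      (top_of_set similarity_params)"

definition image_action :: "nat \<Rightarrow> (real^'n \<Rightarrow> real^'n) \<Rightarrow> (real^'n) set \<Rightarrow> (real^'n) set"
  where "image_action j g = (\<lambda>K\<in>compact_convex_dim_ge j. g ` K)"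

section \<open>Well-definedness\<close>

subsection \<open>The Hausdorff metric\<close>

lemma infdist_le_iff_compact:
  fixes A :: "'a::heine_borel set"
  assumes "compact A" "A \<noteq> {}"
  shows "infdist x A \<le> e \<longleftrightarrow> (\<exists>a\<in>A. dist x a \<le> e)"
proof
  assume "infdist x A \<le> e"
  moreover obtain a where "a \<in> A" "infdist x A = dist x a"
    using infdist_attains_inf[OF compact_imp_closed[OF assms(1)] assms(2)] by blast
  ultimately show "\<exists>a\<in>A. dist x a \<le> e"
    by auto
qed (auto intro: infdist_le2)

lemma bdd_above_infdist:
  assumes "bounded B" "A \<noteq> {}"
  shows "bdd_above ((\<lambda>b. infdist b A) ` B)"
proof -
  obtain a where a: "a \<in> A"
    using assms(2) by blast
  obtain e where "\<And>b. b \<in> B \<Longrightarrow> dist b a \<le> e"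
    using assms(1) by (metis bounded_any_center dist_commute)
  then show ?thesis
    using infdist_le2[OF a] by (intro bdd_aboveI2[where M = e]) auto
qed

lemma hausdorff_dist_le_iff:
  assumes "A \<in> compact_convex_sets" "B \<in> compact_convex_sets"
  shows "hausdorff_dist A B \<le> e \<longleftrightarrow>
    (\<forall>b\<in>B. \<exists>a\<in>A. dist b a \<le> e) \<and> (\<forall>a\<in>A. \<exists>b\<in>B. dist a b \<le> e)"
proof -
  have *: "compact A" "A \<noteq> {}" "compact B" "B \<noteq> {}"
    using assms by (auto simp: compact_convex_sets_def)
  then have **: "bounded A" "bounded B"
    by (auto intro: compact_imp_bounded)
  show ?thesis
    using * ** by (simp add: hausdorff_dist_def cSUP_le_iff bdd_above_infdist infdist_le_iff_compact)
qed

lemma hausdorff_dist_nonneg: "0 \<le> hausdorff_dist A B"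
proof (cases "A = {} \<or> B = {} \<or> \<not> bounded A \<or> \<not> bounded B")
  case False
  then obtain b where b: "b \<in> B"
    by blast
  have "0 \<le> infdist b A"
    by (rule infdist_nonneg)
  also have "\<dots> \<le> (SUP b\<in>B. infdist b A)"
    using False b by (intro cSUP_upper bdd_above_infdist) auto
  finally show ?thesis
    using False by (simp add: hausdorff_dist_def)
qed (auto simp: hausdorff_dist_def)

lemma Metric_space_hausdorff:
  "Metric_space (compact_convex_sets :: 'a::euclidean_space set set) hausdorff_dist"
proof
  fix A B :: "'a set"
  show "0 \<le> hausdorff_dist A B"
    by (rule hausdorff_dist_nonneg)
  show "hausdorff_dist A B = hausdorff_dist B A"
    by (auto simp: hausdorff_dist_def max.commute)
next
  fix A B :: "'a set"
  assume AB: "A \<in> compact_convex_sets" "B \<in> compact_convex_sets"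
  have "hausdorff_dist A B = 0 \<longleftrightarrow> hausdorff_dist A B \<le> 0"
    using hausdorff_dist_nonneg[of A B] by linarith
  also have "\<dots> \<longleftrightarrow> A = B"
    using hausdorff_dist_le_iff[OF AB, of 0] by auto
  finally show "hausdorff_dist A B = 0 \<longleftrightarrow> A = B" .
next
  fix A B C :: "'a set"
  assume A: "A \<in> compact_convex_sets" and B: "B \<in> compact_convex_sets"
    and C: "C \<in> compact_convex_sets"
  note AB = hausdorff_dist_le_iff[OF A B, THEN iffD1, OF order_refl]
    and BC = hausdorff_dist_le_iff[OF B C, THEN iffD1, OF order_refl]
  show "hausdorff_dist A C \<le> hausdorff_dist A B + hausdorff_dist B C"
    unfolding hausdorff_dist_le_iff[OF A C]
  proof (intro conjI ballI)
    fix c assume "c \<in> C"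
    then obtain b where b: "b \<in> B" "dist c b \<le> hausdorff_dist B C"
      using BC by blast
    then obtain a where "a \<in> A" "dist b a \<le> hausdorff_dist A B"
      using AB by blast
    then show "\<exists>a\<in>A. dist c a \<le> hausdorff_dist A B + hausdorff_dist B C"
      using b(2) dist_triangle[of c a b] by force
  next
    fix a assume "a \<in> A"
    then obtain b where b: "b \<in> B" "dist a b \<le> hausdorff_dist A B"
      using AB by blast
    then obtain c where "c \<in> C" "dist b c \<le> hausdorff_dist B C"
      using BC by blast
    then show "\<exists>c\<in>C. dist a c \<le> hausdorff_dist A B + hausdorff_dist B C"
      using b(2) dist_triangle[of a c b] by force
  qed
qed

lemma topspace_hausdorff_topology [simp]: "topspace (hausdorff_topology j) = compact_convex_dim_ge j"
  by (auto simp: hausdorff_topology_def compact_convex_dim_ge_def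
      Metric_space.topspace_mtopology[OF Metric_space_hausdorff])


subsection \<open>The topological group of similarities\<close>

lemma similarity_apply: "similarity (u, r, A) x = u + r *\<^sub>R (A *v x)"
  by (simp add: similarity_def)

lemma norm_orthogonal_matrix_mult:
  fixes A :: "real^'n^'n"
  assumes "orthogonal_matrix A"
  shows "norm (A *v x) = norm x"
proof -
  have "orthogonal_transformation ((*v) A)"
    using assms by (simp add: orthogonal_transformation_matrix)
  then show ?thesis
    by (rule orthogonal_transformation_norm)
qed

lemma inj_on_similarity: "inj_on similarity (similarity_params :: ((real^'n) \<times> real \<times> (real^'n^'n)) set)"
proof (rule inj_onI)
  fix p q :: "(real^'n) \<times> real \<times> (real^'n^'n)"
  assume "p \<in> similarity_params" "q \<in> similarity_params" and eq: "similarity p = similarity q"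
  then obtain u r A v s B where p: "p = (u, r, A)" "r > 0" "orthogonal_matrix A"
    and q: "q = (v, s, B)" "s > 0" "orthogonal_matrix B"
    by (auto simp: similarity_params_def)
  have eq: "u + r *\<^sub>R (A *v x) = v + s *\<^sub>R (B *v x)" for x
    using fun_cong[OF eq, of x] by (simp add: p q similarity_apply)
  have uv: "u = v"
    using eq[of 0] by simp
  have AB: "r *\<^sub>R (A *v x) = s *\<^sub>R (B *v x)" for x
    using eq[of x] uv by simp
  obtain e :: "real^'n" where e: "norm e = 1"
    using vector_choose_size[of 1] by auto
  have rs: "r = s"
    using arg_cong[OF AB[of e], of norm] p q e by (simp add: norm_orthogonal_matrix_mult)
  then have "A *v x = B *v x" for x
    using AB[of x] p(2) by simp
  then have "A = B"
    by (simp add: matrix_eq)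
  with uv rs show "p = q"
    by (simp add: p q)
qed

abbreviation similarity_coords :: "(real^'n \<Rightarrow> real^'n) \<Rightarrow> (real^'n) \<times> real \<times> (real^'n^'n)"
  where "similarity_coords \<equiv> inv_into similarity_params similarity"

lemma similarity_coords_similarity [simp]:
  "p \<in> similarity_params \<Longrightarrow> similarity_coords (similarity p) = p"
  by (rule inv_into_f_f[OF inj_on_similarity])

lemma carrier_similarity_group: "carrier similarity_group = similarity ` similarity_params"
  by (simp add: similarity_group_def)

lemma similarity_coords_in: "g \<in> carrier similarity_group \<Longrightarrow> similarity_coords g \<in> similarity_params"
  by (auto simp: carrier_similarity_group)

lemma similarity_similarity_coords [simp]:
  "g \<in> carrier similarity_group \<Longrightarrow> similarity (similarity_coords g) = g"
  by (auto simp: carrier_similarity_group)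

lemma topspace_similarity_topology [simp]:
  "topspace similarity_topology = carrier similarity_group"
  using similarity_coords_in by (auto simp: similarity_topology_def topspace_pullback_topology)

lemma homeomorphic_maps_similarity:
  "homeomorphic_maps (top_of_set similarity_params) similarity_topology similarity similarity_coords"
  unfolding homeomorphic_maps_def
proof (intro conjI)
  show "continuous_map (top_of_set similarity_params) similarity_topology similarity"
    unfolding similarity_topology_def
  proof (rule continuous_map_pullback')
    show "continuous_map (top_of_set similarity_params) (top_of_set similarity_params)
        (similarity_coords \<circ> similarity)"
      by (rule continuous_map_eq[OF continuous_map_id]) auto
  qed (auto simp: carrier_similarity_group)
  show "continuous_map similarity_topology (top_of_set similarity_params) similarity_coords"
    unfolding similarity_topology_def
    using continuous_map_pullback[OF continuous_map_id] by fastforce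
qed auto

lemma homeomorphic_map_similarity:
  "homeomorphic_map (top_of_set similarity_params) similarity_topology similarity"
  using homeomorphic_maps_similarity by (rule homeomorphic_maps_map[THEN iffD1, THEN conjunct1])

lemmas continuous_map_similarity =
    homeomorphic_maps_similarity[unfolded homeomorphic_maps_def, THEN conjunct1]
  and continuous_map_similarity_coords =
    homeomorphic_maps_similarity[unfolded homeomorphic_maps_def, THEN conjunct2, THEN conjunct1]

definition params_mult ::
  "(real^'n) \<times> real \<times> (real^'n^'n) \<Rightarrow> (real^'n) \<times> real \<times> (real^'n^'n) \<Rightarrow>
   (real^'n) \<times> real \<times> (real^'n^'n)"
  where "params_mult = (\<lambda>(u, r, A) (v, s, B). (u + r *\<^sub>R (A *v v), r * s, A ** B))"

definition params_inv :: "(real^'n) \<times> real \<times> (real^'n^'n) \<Rightarrow> (real^'n) \<times> real \<times> (real^'n^'n)"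
  where "params_inv = (\<lambda>(u, r, A). (- ((1 / r) *\<^sub>R (transpose A *v u)), 1 / r, transpose A))"

lemma params_mult_in:
  "p \<in> similarity_params \<Longrightarrow> q \<in> similarity_params \<Longrightarrow> params_mult p q \<in> similarity_params"
  by (auto simp: similarity_params_def params_mult_def orthogonal_matrix_mul)

lemma params_inv_in: "p \<in> similarity_params \<Longrightarrow> params_inv p \<in> similarity_params"
  by (auto simp: similarity_params_def params_inv_def)

lemma similarity_comp: "similarity p \<circ> similarity q = similarity (params_mult p q)"
  by (auto simp: fun_eq_iff params_mult_def similarity_def matrix_vector_right_distrib
      matrix_vector_mult_scaleR matrix_vector_mul_assoc scaleR_add_right split: prod.split)

lemma params_one_in: "(0, 1, mat 1) \<in> similarity_params"
  by (simp add: similarity_params_def orthogonal_matrix_id)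

lemma similarity_one: "similarity (0, 1, mat 1) = id"
  by (simp add: fun_eq_iff similarity_def)

lemma params_inv_mult:
  "p \<in> similarity_params \<Longrightarrow> params_mult (params_inv p) p = (0, 1, mat 1)"
  by (auto simp: similarity_params_def params_inv_def params_mult_def orthogonal_matrix)

lemma group_similarity_group: "group (similarity_group :: (real^'n \<Rightarrow> real^'n) monoid)"
proof (rule groupI)
  fix g h :: "real^'n \<Rightarrow> real^'n"
  assume "g \<in> carrier similarity_group" "h \<in> carrier similarity_group"
  then show "g \<otimes>\<^bsub>similarity_group\<^esub> h \<in> carrier similarity_group"
    by (auto simp: similarity_group_def similarity_comp params_mult_in)
next
  show "\<one>\<^bsub>similarity_group\<^esub> \<in> carrier (similarity_group :: (real^'n \<Rightarrow> real^'n) monoid)"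
    using imageI[OF params_one_in, of similarity] by (simp add: similarity_group_def similarity_one)
next
  fix g :: "real^'n \<Rightarrow> real^'n"
  assume "g \<in> carrier similarity_group"
  then obtain p where p: "p \<in> similarity_params" "g = similarity p"
    by (auto simp: carrier_similarity_group)
  then have "similarity (params_inv p) \<circ> g = id"
    by (simp add: similarity_comp params_inv_mult similarity_one)
  then show "\<exists>h\<in>carrier similarity_group. h \<otimes>\<^bsub>similarity_group\<^esub> g = \<one>\<^bsub>similarity_group\<^esub>"
    using params_inv_in[OF p(1)] by (auto simp: similarity_group_def)
qed (auto simp: similarity_group_def o_assoc)

lemma inv_similarity:
  assumes "p \<in> similarity_params"
  shows "inv\<^bsub>similarity_group\<^esub> (similarity p) = similarity (params_inv p)"
proof (rule group.inv_equality[OF group_similarity_group])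
  show "similarity (params_inv p) \<otimes>\<^bsub>similarity_group\<^esub> similarity p = \<one>\<^bsub>similarity_group\<^esub>"
    using assms by (simp add: similarity_group_def similarity_comp params_inv_mult similarity_one)
qed (use assms in \<open>simp_all add: carrier_similarity_group params_inv_in\<close>)

lemma continuous_on_matrix_mult:
  fixes f g :: "'a::topological_space \<Rightarrow> real^'n^'n"
  assumes "continuous_on S f" "continuous_on S g"
  shows "continuous_on S (\<lambda>x. f x ** g x)"
  unfolding matrix_matrix_mult_def
  by (intro continuous_on_vec_lambda continuous_on_sum continuous_on_mult continuous_on_component assms)

lemma continuous_on_matrix_vector_mult:
  fixes f :: "'a::topological_space \<Rightarrow> real^'n^'n"
  assumes "continuous_on S f" "continuous_on S g"
  shows "continuous_on S (\<lambda>x. f x *v g x)"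
  unfolding matrix_vector_mult_def
  by (intro continuous_on_vec_lambda continuous_on_sum continuous_on_mult continuous_on_component assms)

lemma continuous_on_matrix_transpose:
  fixes f :: "'a::topological_space \<Rightarrow> real^'n^'n"
  assumes "continuous_on S f"
  shows "continuous_on S (\<lambda>x. transpose (f x))"
  unfolding transpose_def
  by (intro continuous_on_vec_lambda continuous_on_component assms)

lemma topological_group_similarity:
  "topological_group (similarity_group :: (real^'n \<Rightarrow> real^'n) monoid) similarity_topology"
proof -
  let ?G = "similarity_group :: (real^'n \<Rightarrow> real^'n) monoid"
  let ?P = "similarity_params :: ((real^'n) \<times> real \<times> (real^'n^'n)) set"
  let ?T = "similarity_topology :: (real^'n \<Rightarrow> real^'n) topology"
  interpret group ?G
    by (rule group_similarity_group)
  show ?thesis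
  proof
    show "topspace ?T = carrier ?G"
      by simp
    have "continuous_on (?P \<times> ?P) (\<lambda>(p, q). params_mult p q)"
      unfolding params_mult_def case_prod_unfold
      by (intro continuous_intros continuous_on_matrix_mult continuous_on_matrix_vector_mult)
    then have 1: "continuous_map (prod_topology (top_of_set ?P) (top_of_set ?P)) (top_of_set ?P)
        (\<lambda>(p, q). params_mult p q)"
      by (auto simp: prod_topology_subtopology_eu params_mult_in)
    have 2: "continuous_map (prod_topology ?T ?T) (prod_topology (top_of_set ?P) (top_of_set ?P))
        (\<lambda>(g, h). (similarity_coords g, similarity_coords h))"
      using continuous_map_similarity_coords 
      by (auto simp: continuous_map_prod_top simp del: prod_topology_subtopology_eu)
    show "continuous_map (prod_topology ?T ?T) ?T (\<lambda>(g, h). g \<otimes>\<^bsub>?G\<^esub> h)"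
    proof (rule continuous_map_eq[OF continuous_map_compose[OF 2
            continuous_map_compose[OF 1 continuous_map_similarity]]], clarsimp)
      fix g h assume gh: "g \<in> carrier ?G" "h \<in> carrier ?G"
      show "similarity (params_mult (similarity_coords g) (similarity_coords h)) = g \<otimes>\<^bsub>?G\<^esub> h"
        unfolding similarity_comp[symmetric] using gh by (simp add: similarity_group_def)
    qed
    have "continuous_on ?P params_inv"
      unfolding params_inv_def case_prod_unfold
      by (intro continuous_intros continuous_on_matrix_vector_mult continuous_on_matrix_transpose)
        (auto simp: similarity_params_def)
    then have 3: "continuous_map (top_of_set ?P) (top_of_set ?P) params_inv"
      by (auto simp: params_inv_in)
    show "continuous_map ?T ?T (\<lambda>g. inv\<^bsub>?G\<^esub> g)"
    proof (rule continuous_map_eq[OF continuous_map_compose[OF continuous_map_similarity_coords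
            continuous_map_compose[OF 3 continuous_map_similarity]]])
      fix g assume "g \<in> topspace ?T"
      then have g: "g \<in> carrier ?G"
        by simp
      show "((similarity \<circ> params_inv) \<circ> similarity_coords) g = inv\<^bsub>?G\<^esub> g"
        using inv_similarity[OF similarity_coords_in[OF g]] g by simp
    qed
  qed
qed


subsection \<open>The action on compact convex sets\<close>

lemma similarity_image_in:
  assumes "g \<in> carrier similarity_group" "K \<in> compact_convex_dim_ge j"
  shows "g ` K \<in> compact_convex_dim_ge j"
proof -
  obtain u r A where g: "g = similarity (u, r, A)" "r > 0" "orthogonal_matrix A"
    using assms(1) by (auto simp: carrier_similarity_group similarity_params_def)
  define f where "f = (\<lambda>x. r *\<^sub>R (A *v x))"
  have lin: "linear f"
    unfolding f_def by (intro linear_compose_scale_right matrix_vector_mul_linear)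
  have "norm (f x) = r * norm x" for x
    using g by (simp add: f_def norm_orthogonal_matrix_mult)
  then have inj: "inj f"
    using g(2) by (auto simp: linear_injective_0[OF lin] dest: arg_cong[where f = norm])
  have gK: "g ` K = (+) u ` f ` K"
    by (simp add: g similarity_apply f_def image_image)
  have K: "K \<noteq> {}" "compact K" "convex K" "aff_dim K \<ge> int j"
    using assms(2) by (auto simp: compact_convex_dim_ge_def compact_convex_sets_def)
  have "compact (g ` K)" "convex (g ` K)"
    unfolding gK using K lin
    by (auto intro!: compact_translation convex_translation convex_linear_image
        compact_continuous_image linear_continuous_on linear_conv_bounded_linear[THEN iffD1])
  moreover have "aff_dim (g ` K) = aff_dim K"
    unfolding gK by (simp add: aff_dim_translation_eq aff_dim_injective_linear_image[OF lin inj])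
  ultimately show ?thesis
    using K by (simp add: compact_convex_dim_ge_def compact_convex_sets_def)
qed

lemma group_action_image_action:
  "group_action (similarity_group :: (real^'n \<Rightarrow> real^'n) monoid)
     (compact_convex_dim_ge j) (image_action j)"
proof -
  let ?G = "similarity_group :: (real^'n \<Rightarrow> real^'n) monoid"
  let ?K = "compact_convex_dim_ge j :: (real^'n) set set"
  interpret group ?G
    by (rule group_similarity_group)
  have bij: "image_action j g \<in> Bij ?K" if g: "g \<in> carrier ?G" for g
  proof -
    let ?h = "inv\<^bsub>?G\<^esub> g"
    have h: "?h \<in> carrier ?G" "?h \<circ> g = id" "g \<circ> ?h = id"
      using inv_closed[OF g] l_inv[OF g] r_inv[OF g] by (simp_all add: similarity_group_def)
    have "bij_betw ((`) g) ?K ?K"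
      by (rule bij_betw_byWitness[where f' = "(`) ?h"])
        (use similarity_image_in[OF g] similarity_image_in[OF h(1)] h(2,3)
          in \<open>auto simp: image_comp\<close>)
    then show ?thesis
      by (auto simp: Bij_def image_action_def cong: bij_betw_cong)
  qed
  have mult: "image_action j (g \<otimes>\<^bsub>?G\<^esub> h) = compose ?K (image_action j g) (image_action j h)"
    if "g \<in> carrier ?G" "h \<in> carrier ?G" for g h
  proof -
    have "(g \<otimes>\<^bsub>?G\<^esub> h) ` K = g ` h ` K" for K
      by (simp add: similarity_group_def image_comp)
    then show ?thesis
      using similarity_image_in[OF that(2)] by (intro ext) (simp add: image_action_def compose_def)
  qed
  show ?thesis
    unfolding group_action_def group_hom_def group_hom_axioms_def hom_def
    using group_similarity_group group_BijGroup bij mult by (auto simp: BijGroup_def)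
qed

lemma norm_matrix_vector_mult_le:
  fixes A :: "real^'n^'n"
  shows "norm (A *v x) \<le> norm A * norm x"
proof -
  have "norm (A *v x) \<le> L2_set (\<lambda>i. norm (A $ i) * norm x) UNIV"
    unfolding norm_vec_def[of "A *v x"]
    by (intro L2_set_mono) (auto simp: matrix_vector_mul_component Cauchy_Schwarz_ineq2)
  also have "\<dots> = norm A * norm x"
    by (simp add: norm_vec_def[of A] L2_set_left_distrib)
  finally show ?thesis .
qed

lemma G_space_compact_convex_sets:
  "G_space (similarity_group :: (real^'n \<Rightarrow> real^'n) monoid) similarity_topology
     (hausdorff_topology j) (image_action j)"
proof -
  let ?G = "similarity_group :: (real^'n \<Rightarrow> real^'n) monoid"
  let ?P = "similarity_params :: ((real^'n) \<times> real \<times> (real^'n^'n)) set"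
  let ?T = "similarity_topology :: (real^'n \<Rightarrow> real^'n) topology"
  let ?K = "compact_convex_dim_ge j :: (real^'n) set set"
  let ?X = "hausdorff_topology j :: (real^'n) set topology"
  interpret H: Metric_space "compact_convex_sets :: (real^'n) set set" hausdorff_dist
    by (rule Metric_space_hausdorff)
  have sub: "K \<in> compact_convex_sets" if "K \<in> ?K" for K
    using that by (simp add: compact_convex_dim_ge_def)
  have "continuous_map (prod_topology ?T ?X) H.mtopology (\<lambda>(g, K). image_action j g K)"
    unfolding H.continuous_map_to_metric
  proof (intro ballI allI impI, clarsimp)
    fix g :: "real^'n \<Rightarrow> real^'n" and K and e :: real
    assume g: "g \<in> carrier ?G" and K: "K \<in> ?K" and e: "e > 0"
    obtain u r A where urA: "(u, r, A) \<in> ?P" "g = similarity (u, r, A)" "r > 0"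
      using g by (auto simp: carrier_similarity_group similarity_params_def)
    have "bounded K"
      using sub[OF K] by (simp add: compact_convex_sets_def compact_imp_bounded)
    then obtain M where M: "M > 0" "\<And>x. x \<in> K \<Longrightarrow> norm x \<le> M"
      by (auto simp: bounded_pos)
    define d where "d = e / (2 * (r + 1) + 1)"
    have d: "d > 0" "(r + 1) * d < e / 2"
      using e urA(3) by (auto simp: d_def field_simps add_pos_pos)
    define F :: "(real^'n) \<times> real \<times> (real^'n^'n) \<Rightarrow> real"
      where "F = (\<lambda>(v, s, B). norm (v - u) + norm (s *\<^sub>R B - r *\<^sub>R A) * M)"
    define W where "W = {p \<in> ?P. F p < e / 2 \<and> fst (snd p) < r + 1}"
    have "continuous_on ?P F"
      unfolding F_def case_prod_unfold by (intro continuous_intros)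
    then have "openin (top_of_set ?P) {p \<in> ?P. F p < e / 2}"
      using continuous_openin_preimage_gen[of ?P F "{..<e / 2}"] by (simp add: vimage_def Int_def)
    moreover have "openin (top_of_set ?P) {p \<in> ?P. fst (snd p) < r + 1}"
      using continuous_openin_preimage_gen[of ?P "\<lambda>p. fst (snd p)" "{..<r + 1}"]
      by (simp add: vimage_def Int_def continuous_on_fst continuous_on_snd)
    moreover have "W = {p \<in> ?P. F p < e / 2} \<inter> {p \<in> ?P. fst (snd p) < r + 1}"
      by (auto simp: W_def)
    ultimately have "openin (top_of_set ?P) W"
      by auto
    then have oU: "openin ?T {h \<in> topspace ?T. similarity_coords h \<in> W}"
      by (rule openin_continuous_map_preimage[OF continuous_map_similarity_coords])
    have oV: "openin ?X (H.mball K d \<inter> ?K)"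
      unfolding hausdorff_topology_def by (intro openin_subtopology_Int H.openin_mball)
    have "(u, r, A) \<in> W"
      using urA e by (simp add: W_def F_def)
    then have "similarity_coords g \<in> W"
      using urA by simp
    then have "(g, K) \<in> {h \<in> topspace ?T. similarity_coords h \<in> W} \<times> (H.mball K d \<inter> ?K)"
      using g K sub[OF K] d(1) by auto
    moreover have "image_action j g K \<in> compact_convex_sets \<and> image_action j h L \<in> compact_convex_sets
        \<and> hausdorff_dist (image_action j g K) (image_action j h L) < e"
      if hU: "h \<in> carrier ?G" and hW: "similarity_coords h \<in> W" and LV: "L \<in> H.mball K d" and L: "L \<in> ?K"
      for h L
    proof -
      obtain v s B where vsB: "similarity_coords h = (v, s, B)"
        by (metis prod_cases3)
      then have h: "h = similarity (v, s, B)"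
        using hU by (metis similarity_similarity_coords)
      have P: "(v, s, B) \<in> ?P" "norm (v - u) + norm (s *\<^sub>R B - r *\<^sub>R A) * M < e / 2" "s < r + 1"
        using hW by (auto simp: vsB W_def F_def)
      then have s: "s > 0" "orthogonal_matrix B"
        by (auto simp: similarity_params_def)
      have close: "dist (g x) (h y) \<le> norm (v - u) + norm (s *\<^sub>R B - r *\<^sub>R A) * M + (r + 1) * d"
        if x: "x \<in> K" and xy: "dist x y \<le> d" for x y
      proof -
        have "dist (g x) (h x) = norm ((v - u) + (s *\<^sub>R B - r *\<^sub>R A) *v x)"
          by (subst dist_commute) (simp add: dist_norm urA(2) h similarity_apply
              matrix_vector_mult_diff_rdistrib scaleR_matrix_vector_assoc algebra_simps)
        also have "\<dots> \<le> norm (v - u) + norm ((s *\<^sub>R B - r *\<^sub>R A) *v x)"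
          by (rule norm_triangle_ineq)
        also have "norm ((s *\<^sub>R B - r *\<^sub>R A) *v x) \<le> norm (s *\<^sub>R B - r *\<^sub>R A) * norm x"
          by (rule norm_matrix_vector_mult_le)
        also have "\<dots> \<le> norm (s *\<^sub>R B - r *\<^sub>R A) * M"
          using M(2)[OF x] by (intro mult_left_mono) auto
        finally have 1: "dist (g x) (h x) \<le> norm (v - u) + norm (s *\<^sub>R B - r *\<^sub>R A) * M"
          by simp
        have "h x - h y = s *\<^sub>R (B *v (x - y))"
          by (simp add: h similarity_apply matrix_vector_mult_diff_distrib algebra_simps)
        then have "dist (h x) (h y) = s * dist x y"
          using s by (simp add: dist_norm norm_orthogonal_matrix_mult)
        also have "\<dots> \<le> (r + 1) * d"
          using s P xy urA(3) by (intro mult_mono) auto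
        finally show ?thesis
          using 1 dist_triangle[of "g x" "h y" "h x"] by linarith
      qed
      have gK: "g ` K \<in> compact_convex_sets" and hL: "h ` L \<in> compact_convex_sets"
        using similarity_image_in[OF g K] similarity_image_in[OF hU L] sub by auto
      have "hausdorff_dist K L \<le> d"
        using LV by simp
      note KL = this[unfolded hausdorff_dist_le_iff[OF sub[OF K] sub[OF L]]]
      have "hausdorff_dist (g ` K) (h ` L)
          \<le> norm (v - u) + norm (s *\<^sub>R B - r *\<^sub>R A) * M + (r + 1) * d"
        unfolding hausdorff_dist_le_iff[OF gK hL]
      proof (intro conjI ballI)
        fix b assume "b \<in> h ` L"
        then obtain y where y: "y \<in> L" "b = h y"
          by blast
        then obtain x where "x \<in> K" "dist y x \<le> d"
          using KL by blast
        then show "\<exists>a\<in>g ` K. dist b a \<le> norm (v - u) + norm (s *\<^sub>R B - r *\<^sub>R A) * M + (r + 1) * d"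
          using close[of x y] y by (auto simp: dist_commute)
      next
        fix a assume "a \<in> g ` K"
        then obtain x where x: "x \<in> K" "a = g x"
          by blast
        then obtain y where "y \<in> L" "dist x y \<le> d"
          using KL by blast
        then show "\<exists>b\<in>h ` L. dist a b \<le> norm (v - u) + norm (s *\<^sub>R B - r *\<^sub>R A) * M + (r + 1) * d"
          using close[of x y] x by auto
      qed
      also have "\<dots> < e"
        using P(2) d(2) by linarith
      finally show ?thesis
        using gK hL K L by (simp add: image_action_def)
    qed
    ultimately show "\<exists>U. openin (prod_topology ?T ?X) U \<and> (g, K) \<in> U \<and>
        (\<forall>y\<in>U. image_action j g K \<in> compact_convex_sets \<and>
           (case y of (h, L) \<Rightarrow> image_action j h L) \<in> compact_convex_sets \<and>
           hausdorff_dist (image_action j g K) (case y of (h, L) \<Rightarrow> image_action j h L) < e)"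
      using oU oV
      by (intro exI[of _ "{h \<in> topspace ?T. similarity_coords h \<in> W} \<times> (H.mball K d \<inter> ?K)"])
         (auto simp: openin_prod_Times_iff simp del: H.in_mball)
  qed
  then have "continuous_map (prod_topology ?T ?X) ?X (\<lambda>(g, K). image_action j g K)"
    using continuous_map_in_subtopology[of "prod_topology ?T ?X" H.mtopology ?K
        "\<lambda>(g, K). image_action j g K", folded hausdorff_topology_def]
    by (auto simp: image_action_def similarity_image_in)
  then show ?thesis
    unfolding G_space_def G_space_axioms_def
    using topological_group_similarity group_action_image_action by auto
qed

end

theory Submission
  imports Defs
begin

text \<open>
  The circumscribed ball of a compact convex set \<open>K\<close> with more than one point has a unique centre
  \<open>c\<close> and a positive radius \<open>r\<close>, which depend continuously on \<open>K\<close>, so that \<open>x \<mapsto> c + r x\<close> is a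
  similarity that varies continuously with \<open>K\<close>. Writing \<open>K\<close> as the image of its \<open>shape\<close> under
  this \<open>frame\<close> removes the non-compact part of the group: a similarity with rotation part \<open>A\<close>
  acts on shapes by \<open>A\<close> (\<open>shape_similarity_image\<close>). It therefore suffices to find an \<open>O(n)\<close>-equivariant continuous map
  \<open>F\<close> on compact convex sets with prescribed values at finitely many shapes; the required map is then
  \<open>K \<mapsto> frame K ` F (shape K)\<close>.

  Equivariance forces the values of \<open>F\<close> on the orbits of these shapes, and the hypotheses on stabilizers and
  orbits make the forced values consistent (\<open>orbit_map_well_defined\<close>). As \<open>O(n)\<close> is
  compact, the arguments and forced values form a compact, rotation-invariant graph \<open>P\<close> of pairs of convex sets.
  So everything rests on an extension theorem for functions with compact graph whose extension inherits
  all the symmetries of the graph, \<open>equivariant_extension_of_compact_graph\<close>.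

  Averaging over the group would need Haar measure. Instead, the extension is given by a formula
  that involves nothing but distances, so that it commutes with every symmetry by
  construction. By compactness the function on the graph has a subadditive modulus of continuity
  \<open>\<omega>\<close>, and \<open>\<omega>\<close> applied to the Hausdorff distance from a set \<open>K\<close> to the first components of the
  pairs \<open>p = (A, B)\<close> in \<open>P\<close> gives distances \<open>D K p\<close> with minimum \<open>\<delta>\<close>. The value at \<open>K\<close> is the closed
  convex hull of the parallel bodies of \<open>B\<close> with radius \<open>6 \<delta> - 2 D K p\<close>, where negative radii
  contribute nothing. On the graph \<open>\<delta> = 0\<close>, and only the prescribed value is left. Off the graph the hull
  contains a ball, so that its dimension is \<open>n \<ge> m\<close>. It depends continuously on \<open>K\<close>, even
  though pieces appear and disappear, because a piece of radius zero lies inside the piece of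
  the nearest point, which has radius \<open>4 \<delta>\<close>.
\<close>

section \<open>Parallel bodies\<close>

definition thicken :: "'a::euclidean_space set \<Rightarrow> real \<Rightarrow> 'a set"
  where "thicken A e = {z. \<exists>a\<in>A. dist z a \<le> e}"

lemma hausdorff_dist_le_iff_thicken:
  assumes "A \<in> compact_convex_sets" "B \<in> compact_convex_sets"
  shows "hausdorff_dist A B \<le> e \<longleftrightarrow> B \<subseteq> thicken A e \<and> A \<subseteq> thicken B e"
  unfolding hausdorff_dist_le_iff[OF assms] thicken_def by auto

lemma thicken_mono: "A \<subseteq> B \<Longrightarrow> d \<le> e \<Longrightarrow> thicken A d \<subseteq> thicken B e"
  unfolding thicken_def by (auto intro: order_trans)

lemma thicken_thicken: "thicken (thicken A d) e \<subseteq> thicken A (d + e)"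
proof
  fix z assume "z \<in> thicken (thicken A d) e"
  then obtain y a where "a \<in> A" "dist z y \<le> e" "dist y a \<le> d"
    unfolding thicken_def by blast
  then show "z \<in> thicken A (d + e)"
    unfolding thicken_def using dist_triangle[of z a y] by force
qed

lemma thicken_neg: "e < 0 \<Longrightarrow> thicken A e = {}"
  by (auto simp: thicken_def not_le intro: less_le_trans[OF _ zero_le_dist])

lemma thicken_eq_sums: "thicken A e = (\<Union>a\<in>A. \<Union>v\<in>cball 0 e. {a + v})"
proof (intro Set.set_eqI iffI)
  fix z assume "z \<in> thicken A e"
  then obtain a where a: "a \<in> A" "z - a \<in> cball 0 e"
    by (force simp: thicken_def dist_norm norm_minus_commute)
  moreover have "z = a + (z - a)"
    by simp
  ultimately show "z \<in> (\<Union>a\<in>A. \<Union>v\<in>cball 0 e. {a + v})"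
    by blast
qed (auto simp: thicken_def dist_norm intro!: bexI)

lemma compact_thicken: "compact A \<Longrightarrow> compact (thicken A e)"
  unfolding thicken_eq_sums by (intro compact_sums' compact_cball)

lemma convex_thicken: "convex A \<Longrightarrow> convex (thicken A e)"
  unfolding thicken_eq_sums by (intro convex_sums convex_cball)

lemma subset_thicken: "0 \<le> e \<Longrightarrow> A \<subseteq> thicken A e"
  unfolding thicken_def by force

text \<open>Balls add up in a normed space: a point at distance at most \<open>d + e\<close> from \<open>a\<close> is reached
  through a point of the segment at distance \<open>d\<close> from \<open>a\<close>.\<close>

lemma thicken_add:
  assumes "0 \<le> d" "0 \<le> e"
  shows "thicken A (d + e) = thicken (thicken A d) e"
proof
  show "thicken A (d + e) \<subseteq> thicken (thicken A d) e"
  proof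
    fix z assume "z \<in> thicken A (d + e)"
    then obtain a where a: "a \<in> A" "dist z a \<le> d + e"
      by (auto simp: thicken_def)
    show "z \<in> thicken (thicken A d) e"
    proof (cases "dist z a \<le> d")
      case True
      then show ?thesis
        using a assms subset_thicken[of e "thicken A d"] by (auto simp: thicken_def)
    next
      case False
      then have d: "dist z a > 0" "dist z a > d"
        using assms by linarith+
      define w where "w = a + (d / dist z a) *\<^sub>R (z - a)"
      have "dist w a = d"
        using d assms by (simp add: w_def dist_norm)
      moreover have "z - w = (1 - d / dist z a) *\<^sub>R (z - a)"
        by (simp add: w_def algebra_simps)
      then have "dist z w = \<bar>1 - d / dist z a\<bar> * dist z a"
        by (simp add: dist_norm)
      then have "dist z w = (1 - d / dist z a) * dist z a"
        using d by simp
      then have "dist z w = dist z a - d"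
        using d(1) by (simp add: left_diff_distrib del: zero_less_dist_iff)
      ultimately show ?thesis
        using a unfolding thicken_def by force
    qed
  qed
qed (rule thicken_thicken)

lemma thicken_isometry_image:
  fixes h :: "'a::euclidean_space \<Rightarrow> 'a"
  assumes "orthogonal_transformation h"
  shows "thicken (h ` A) e = h ` thicken A e"
proof -
  have "dist (h x) (h y) = dist x y" for x y
    using assms by (simp add: orthogonal_transformation_isometry)
  moreover have "surj h"
    using orthogonal_transformation_linear[OF assms] orthogonal_transformation_inj[OF assms]
    by (rule linear_inj_imp_surj)
  ultimately show ?thesis
    unfolding thicken_def by (fastforce simp: image_iff surj_def)
qed

section \<open>Moduli of continuity\<close>

text \<open>The modulus is the infimum of all increasing affine functions that dominate \<open>\<beta>\<close> in terms of \<open>\<alpha>\<close>.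
  As an infimum of such functions it is increasing and concave, and a nonnegative concave function
  is subadditive. Subadditivity and monotonicity let \<open>\<omega>\<close> of a metric satisfy the triangle inequality.\<close>

lemma subadditive_modulus_exists:
  fixes \<alpha> \<beta> :: "'z \<Rightarrow> real"
  assumes nonneg: "\<And>z. z \<in> Z \<Longrightarrow> 0 \<le> \<alpha> z" "\<And>z. z \<in> Z \<Longrightarrow> 0 \<le> \<beta> z"
    and control: "\<And>e. e > 0 \<Longrightarrow> \<exists>c\<ge>0. \<forall>z\<in>Z. \<beta> z \<le> e + c * \<alpha> z"
  obtains \<omega> :: "real \<Rightarrow> real" where "\<omega> 0 = 0"
    and "\<And>s t. 0 \<le> s \<Longrightarrow> s \<le> t \<Longrightarrow> \<omega> s \<le> \<omega> t"
    and "\<And>s t. 0 \<le> s \<Longrightarrow> 0 \<le> t \<Longrightarrow> \<omega> (s + t) \<le> \<omega> s + \<omega> t"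
    and "\<And>e. e > 0 \<Longrightarrow> \<exists>d>0. \<omega> d < e"
    and "\<And>z. z \<in> Z \<Longrightarrow> \<beta> z \<le> \<omega> (\<alpha> z)"
proof -
  define L where "L = {(e, c). 0 \<le> e \<and> 0 \<le> c \<and> (\<forall>z\<in>Z. \<beta> z \<le> e + c * \<alpha> z)}"
  define \<omega> where "\<omega> t = (INF (e, c)\<in>L. e + c * t)" for t
  have L0: "0 \<le> e" "0 \<le> c" if "(e, c) \<in> L" for e c
    using that by (auto simp: L_def)
  have ne: "L \<noteq> {}"
  proof -
    obtain c where "c \<ge> 0" "\<forall>z\<in>Z. \<beta> z \<le> 1 + c * \<alpha> z"
      using control[of 1] by auto
    then have "(1, c) \<in> L"
      by (simp add: L_def)
    then show ?thesis
      by blast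
  qed
  have low: "\<omega> t \<le> e + c * t" if "(e, c) \<in> L" "0 \<le> t" for e c t
    unfolding \<omega>_def
    by (rule cINF_lower2[OF _ that(1)])
      (use L0 that(2) in \<open>auto intro!: bdd_belowI2[where m = 0] split: prod.splits\<close>)
  have great: "m \<le> \<omega> t" if "\<And>e c. (e, c) \<in> L \<Longrightarrow> m \<le> e + c * t" for m t
    unfolding \<omega>_def by (rule cINF_greatest[OF ne]) (use that in auto)
  have small: "\<exists>d>0. \<omega> d < e" if "e > 0" for e
  proof -
    obtain c where c: "c \<ge> 0" "(e / 2, c) \<in> L"
      using control[of "e / 2"] \<open>e > 0\<close> by (auto simp: L_def)
    define d where "d = e / (2 * (c + 1))"
    have "d > 0" "c * d < e / 2"
      using c(1) \<open>e > 0\<close> by (auto simp: d_def field_simps add_pos_pos)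
    with low[OF c(2), of d] show ?thesis
      by (intro exI[of _ d]) auto
  qed
  have mono: "\<omega> s \<le> \<omega> t" if "0 \<le> s" "s \<le> t" for s t
  proof (rule great)
    fix e c assume ec: "(e, c) \<in> L"
    then have "\<omega> s \<le> e + c * s"
      using low that by blast
    also have "\<dots> \<le> e + c * t"
      using L0[OF ec] that by (simp add: mult_left_mono)
    finally show "\<omega> s \<le> e + c * t" .
  qed
  have pos: "0 \<le> \<omega> t" if "0 \<le> t" for t
    by (rule great) (use L0 that in auto)
  have "\<omega> 0 = 0"
  proof (rule ccontr)
    assume "\<omega> 0 \<noteq> 0"
    then obtain d where "d > 0" "\<omega> d < \<omega> 0"
      using small[of "\<omega> 0"] pos[of 0] by auto
    then show False
      using mono[of 0 d] by auto
  qed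
  moreover have "\<omega> (s + t) \<le> \<omega> s + \<omega> t" if st: "0 \<le> s" "0 \<le> t" for s t
  proof (cases "s + t = 0")
    case False
    then have p: "s + t > 0"
      using st by auto
    \<comment> \<open>By concavity \<open>\<omega> r / r\<close> is decreasing; this is compared at \<open>r = s\<close> and \<open>r = t\<close> with its value at \<open>s + t\<close>.\<close>
    have "r / (s + t) * \<omega> (s + t) \<le> \<omega> r" if r: "0 \<le> r" "r \<le> s + t" for r
    proof (rule great)
      fix e c assume ec: "(e, c) \<in> L"
      have "r / (s + t) * \<omega> (s + t) \<le> r / (s + t) * (e + c * (s + t))"
        using low[OF ec, of "s + t"] st r by (intro mult_left_mono) auto
      also have "\<dots> = r / (s + t) * e + c * r"
        using p by (simp add: field_simps)
      also have "r / (s + t) * e \<le> 1 * e"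
        using L0[OF ec] p r by (intro mult_right_mono) auto
      finally show "r / (s + t) * \<omega> (s + t) \<le> e + c * r"
        by simp
    qed
    from this[of s] this[of t]
    have "s / (s + t) * \<omega> (s + t) + t / (s + t) * \<omega> (s + t) \<le> \<omega> s + \<omega> t"
      using st by simp
    also have "s / (s + t) * \<omega> (s + t) + t / (s + t) * \<omega> (s + t) = \<omega> (s + t)"
      using p by (simp flip: distrib_right add_divide_distrib)
    finally show ?thesis .
  next
    case True
    then have "s = 0" "t = 0"
      using st by auto
    then show ?thesis
      using pos[of 0] by simp
  qed
  moreover have "\<beta> z \<le> \<omega> (\<alpha> z)" if "z \<in> Z" for z
    by (rule great) (use that in \<open>auto simp: L_def\<close>)
  ultimately show thesis
    using that mono small by blast
qed

text \<open>Where \<open>\<alpha>\<close> vanishes there is nothing to pay, and elsewhere a large multiple of \<open>\<alpha>\<close> suffices;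
  the open sets on which the multiple \<open>n\<close> suffices increase with \<open>n\<close>, so compactness gives one \<open>n\<close> for
  all points.\<close>

lemma compact_linear_control:
  assumes "compact_space Z" "continuous_map Z euclideanreal \<alpha>" "continuous_map Z euclideanreal \<beta>"
    and "\<And>z. z \<in> topspace Z \<Longrightarrow> 0 \<le> \<alpha> z"
    and zero: "\<And>z. z \<in> topspace Z \<Longrightarrow> \<alpha> z = 0 \<Longrightarrow> \<beta> z \<le> 0"
    and "e > 0"
  shows "\<exists>c\<ge>0. \<forall>z\<in>topspace Z. \<beta> z \<le> e + c * \<alpha> z"
proof -
  define U where "U n = {z \<in> topspace Z. \<beta> z - real n * \<alpha> z < e}" for n
  have "openin Z (U n)" for n
    unfolding U_def
    using openin_continuous_map_preimage[of Z euclideanreal "\<lambda>z. \<beta> z - real n * \<alpha> z" "{..<e}",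
        OF continuous_map_diff[OF assms(3) continuous_map_real_mult_left[OF assms(2)]]]
    by auto
  moreover have "topspace Z \<subseteq> (\<Union>n. U n)"
  proof
    fix z assume z: "z \<in> topspace Z"
    show "z \<in> (\<Union>n. U n)"
    proof (cases "\<alpha> z = 0")
      case True
      then show ?thesis
        using zero[OF z] z \<open>e > 0\<close> by (auto simp: U_def)
    next
      case False
      then have "\<alpha> z > 0"
        using assms(4)[OF z] by auto
      then obtain n where "\<beta> z < real n * \<alpha> z"
        using reals_Archimedean3 by blast
      then show ?thesis
        using z \<open>e > 0\<close> by (auto simp: U_def intro!: exI[of _ n])
    qed
  qed
  ultimately obtain \<F> where F: "finite \<F>" "\<F> \<subseteq> range U" "topspace Z \<subseteq> \<Union>\<F>"
    using assms(1) unfolding compact_space_alt by (metis (no_types, lifting) imageE)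
  then obtain I where I: "finite I" "\<F> = U ` I"
    by (meson finite_subset_image)
  define N where "N = Max (insert 0 I)"
  have "\<beta> z \<le> e + real N * \<alpha> z" if z: "z \<in> topspace Z" for z
  proof -
    obtain n where n: "n \<in> I" "z \<in> U n"
      using F(3) I z by blast
    then have "n \<le> N"
      using I by (simp add: N_def)
    then have "real n * \<alpha> z \<le> real N * \<alpha> z"
      using assms(4)[OF z] by (intro mult_right_mono) auto
    then show ?thesis
      using n by (auto simp: U_def)
  qed
  then show ?thesis
    by (intro exI[of _ "real N"]) auto
qed

section \<open>Interpolation of convex sets\<close>

text \<open>
  \<open>D x p\<close> is thought of as the distance of \<open>x\<close> from a node \<open>p\<close> with the prescribed value \<open>b p\<close>. The last
  assumption says that the values are 1-Lipschitz along paths from node to node through \<open>x\<close>.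
\<close>

locale convex_set_interpolation =
  fixes X :: "'x set" and P :: "'p set" and D :: "'x \<Rightarrow> 'p \<Rightarrow> real"
    and b :: "'p \<Rightarrow> 'a::euclidean_space set"
  assumes b_in: "p \<in> P \<Longrightarrow> b p \<in> compact_convex_sets"
    and D_nonneg: "x \<in> X \<Longrightarrow> p \<in> P \<Longrightarrow> 0 \<le> D x p"
    and nearest: "x \<in> X \<Longrightarrow> \<exists>p\<in>P. \<forall>q\<in>P. D x p \<le> D x q"
    and b_dist: "x \<in> X \<Longrightarrow> p \<in> P \<Longrightarrow> q \<in> P \<Longrightarrow> hausdorff_dist (b p) (b q) \<le> D x p + D x q"
begin

definition gap :: "'x \<Rightarrow> real"
  where "gap x = Inf (D x ` P)"

text \<open>
  The constants 6 and 2 make the union of pieces continuous. A piece has nonnegative radius iff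
  \<open>D x p \<le> 3 * gap x\<close>; then \<open>b p\<close> is within \<open>3 * gap x + gap x\<close> of the value at a nearest node, and this
  is the radius \<open>(6 - 2) * gap x\<close> of the nearest piece. So a piece is already covered when it appears.
\<close>

definition pieces :: "'x \<Rightarrow> 'a set"
  where "pieces x = (\<Union>p\<in>P. thicken (b p) (6 * gap x - 2 * D x p))"

definition interpolant :: "'x \<Rightarrow> 'a set"
  where "interpolant x = closure (convex hull (pieces x))"

lemma gap_attained:
  assumes "x \<in> X"
  obtains p where "p \<in> P" "D x p = gap x" "\<And>q. q \<in> P \<Longrightarrow> gap x \<le> D x q" "0 \<le> gap x"
proof -
  obtain p where p: "p \<in> P" "\<And>q. q \<in> P \<Longrightarrow> D x p \<le> D x q"
    using nearest[OF assms] by blast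
  then have "gap x = D x p"
    unfolding gap_def by (intro cInf_eq_minimum) auto
  then show thesis
    using that p D_nonneg[OF assms p(1)] by simp
qed

lemma b_subset_thicken:
  assumes "x \<in> X" "p \<in> P" "q \<in> P"
  shows "b p \<subseteq> thicken (b q) (D x p + D x q)"
  using b_dist[OF assms] hausdorff_dist_le_iff_thicken[OF b_in b_in] assms by blast

lemma interpolant_subset:
  assumes "closed T" "convex T"
    and "\<And>p. p \<in> P \<Longrightarrow> 2 * D x p \<le> 6 * gap x \<Longrightarrow> thicken (b p) (6 * gap x - 2 * D x p) \<subseteq> T"
  shows "interpolant x \<subseteq> T"
proof -
  have "pieces x \<subseteq> T"
    unfolding pieces_def
  proof (rule UN_least)
    fix p assume "p \<in> P"
    then show "thicken (b p) (6 * gap x - 2 * D x p) \<subseteq> T"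
      using assms(3)[of p] thicken_neg[of "6 * gap x - 2 * D x p" "b p"] by (cases "2 * D x p \<le> 6 * gap x") auto
  qed
  then show ?thesis
    unfolding interpolant_def by (intro closure_minimal hull_minimal assms)
qed

lemma thicken_subset_interpolant:
  "p \<in> P \<Longrightarrow> thicken (b p) (6 * gap x - 2 * D x p) \<subseteq> interpolant x"
  unfolding interpolant_def pieces_def
  by (rule order_trans[OF _ closure_subset], rule order_trans[OF _ hull_subset]) auto

text \<open>Every node whose piece is present is at distance at most \<open>4 * gap x\<close> in value from a nearest
  node \<open>p\<close>, and its radius is at most \<open>6 * gap x\<close>; so the union is bounded.\<close>

lemma interpolant_in:
  assumes "x \<in> X"
  shows "interpolant x \<in> compact_convex_sets"
proof -
  obtain p where p: "p \<in> P" "D x p = gap x" "0 \<le> gap x"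
    using gap_attained[OF assms] by metis
  have b: "compact (b p)" "convex (b p)" "b p \<noteq> {}"
    using b_in[OF p(1)] by (auto simp: compact_convex_sets_def)
  have "interpolant x \<subseteq> thicken (b p) (10 * gap x)"
  proof (rule interpolant_subset)
    fix q assume q: "q \<in> P" "2 * D x q \<le> 6 * gap x"
    have "thicken (b q) (6 * gap x - 2 * D x q)
        \<subseteq> thicken (thicken (b p) (D x q + D x p)) (6 * gap x - 2 * D x q)"
      by (intro thicken_mono b_subset_thicken assms p q order_refl)
    also have "\<dots> \<subseteq> thicken (b p) ((D x q + D x p) + (6 * gap x - 2 * D x q))"
      by (rule thicken_thicken)
    also have "\<dots> \<subseteq> thicken (b p) (10 * gap x)"
      using p D_nonneg[OF assms q(1)] by (intro thicken_mono) auto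
    finally show "thicken (b q) (6 * gap x - 2 * D x q) \<subseteq> thicken (b p) (10 * gap x)" .
  qed (use b in \<open>auto intro: compact_imp_closed compact_thicken convex_thicken\<close>)
  then have "bounded (interpolant x)"
    using b by (meson bounded_subset compact_imp_bounded compact_thicken)
  then have "compact (interpolant x)"
    unfolding compact_eq_bounded_closed by (simp add: interpolant_def)
  moreover have "convex (interpolant x)"
    unfolding interpolant_def by (intro convex_closure convex_convex_hull)
  moreover have "interpolant x \<noteq> {}"
    using thicken_subset_interpolant[OF p(1), of x] subset_thicken[of "4 * gap x" "b p"] p b by auto
  ultimately show ?thesis
    by (simp add: compact_convex_sets_def)
qed

text \<open>Each piece at \<open>x\<close> is compared with the same piece at \<open>y\<close> if that is present, and with the nearest piece
  at \<open>y\<close> otherwise. The radii \<open>6 * gap - 2 * D\<close> change by at most \<open>8 * e\<close> between \<open>x\<close> and \<open>y\<close>, so a piece that is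
  present at \<open>x\<close> misses being present at \<open>y\<close> by at most this amount.\<close>

lemma interpolant_subset_thicken:
  assumes x: "x \<in> X" and y: "y \<in> X" and close: "\<And>p. p \<in> P \<Longrightarrow> \<bar>D x p - D y p\<bar> \<le> e"
  shows "interpolant x \<subseteq> thicken (interpolant y) (12 * e)"
proof (rule interpolant_subset)
  show "closed (thicken (interpolant y) (12 * e))" "convex (thicken (interpolant y) (12 * e))"
    using interpolant_in[OF y]
    by (auto simp: compact_convex_sets_def intro: compact_imp_closed compact_thicken convex_thicken)
next
  fix p assume p: "p \<in> P" and px: "2 * D x p \<le> 6 * gap x"
  obtain px0 where x0: "px0 \<in> P" "D x px0 = gap x" "\<And>q. q \<in> P \<Longrightarrow> gap x \<le> D x q"
    using gap_attained[OF x] by metis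
  obtain q where q: "q \<in> P" "D y q = gap y" "0 \<le> gap y" "\<And>r. r \<in> P \<Longrightarrow> gap y \<le> D y r"
    using gap_attained[OF y] by metis
  have e: "e \<ge> 0"
    using close[OF p] by linarith
  have gap: "gap x \<le> gap y + e" "gap y \<le> gap x + e"
    using x0(3)[OF q(1)] q(4)[OF x0(1)] close[OF q(1)] close[OF x0(1)] q(2) x0(2) by linarith+
  let ?rx = "6 * gap x - 2 * D x p" and ?ry = "6 * gap y - 2 * D y p"
  have r: "?rx \<le> ?ry + 8 * e" "- (8 * e) \<le> ?ry"
    using gap close[OF p] px by linarith+
  show "thicken (b p) ?rx \<subseteq> thicken (interpolant y) (12 * e)"
  proof (cases "0 \<le> ?ry")
    case True
    have "thicken (b p) ?rx \<subseteq> thicken (b p) (?ry + 8 * e)"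
      using r by (intro thicken_mono) auto
    also have "\<dots> = thicken (thicken (b p) ?ry) (8 * e)"
      using True e by (intro thicken_add) auto
    also have "\<dots> \<subseteq> thicken (interpolant y) (12 * e)"
      using e by (intro thicken_mono thicken_subset_interpolant p) auto
    finally show ?thesis .
  next
    case False
    \<comment> \<open>Here \<open>D y p \<le> 3 * gap y + 4 * e\<close> and the radius at \<open>x\<close> is at most \<open>8 * e\<close>, so the piece
      exceeds the nearest piece by at most \<open>12 * e\<close>.\<close>
    have "thicken (b p) ?rx \<subseteq> thicken (thicken (b q) (D y p + D y q)) ?rx"
      by (intro thicken_mono b_subset_thicken y p q order_refl)
    also have "\<dots> \<subseteq> thicken (thicken (thicken (b q) (4 * gap y)) (4 * e)) (8 * e)"
    proof (rule thicken_mono)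
      show "thicken (b q) (D y p + D y q) \<subseteq> thicken (thicken (b q) (4 * gap y)) (4 * e)"
        unfolding thicken_add[OF mult_nonneg_nonneg[OF _ q(3)] mult_nonneg_nonneg[OF _ e],
            of 4 4, simplified, symmetric]
        by (rule thicken_mono[OF order_refl]) (use r(2) q(2) in linarith)
    qed (use r False in auto)
    also have "\<dots> \<subseteq> thicken (thicken (b q) (4 * gap y)) (12 * e)"
      using thicken_thicken[of _ "4 * e" "8 * e"] by simp
    also have "\<dots> \<subseteq> thicken (interpolant y) (12 * e)"
      using thicken_subset_interpolant[OF q(1), of y] q(2) by (intro thicken_mono) auto
    finally show ?thesis .
  qed
qed

lemma hausdorff_dist_interpolant:
  assumes x: "x \<in> X" and y: "y \<in> X" and close: "\<And>p. p \<in> P \<Longrightarrow> \<bar>D x p - D y p\<bar> \<le> e"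
  shows "hausdorff_dist (interpolant x) (interpolant y) \<le> 12 * e"
  unfolding hausdorff_dist_le_iff_thicken[OF interpolant_in[OF x] interpolant_in[OF y]]
  using interpolant_subset_thicken[OF x y close] interpolant_subset_thicken[OF y x] close
  by (simp add: abs_minus_commute)

text \<open>If the gap is 0, then all pieces present at \<open>x\<close> have radius 0 and belong to nodes at distance 0,
  whose values coincide.\<close>

lemma interpolant_eq:
  assumes x: "x \<in> X" and p: "p \<in> P" "D x p = 0"
  shows "interpolant x = b p"
proof
  have gap: "gap x = 0"
    using gap_attained[OF x] p by (metis order_antisym)
  have b: "compact (b p)" "convex (b p)"
    using b_in[OF p(1)] by (auto simp: compact_convex_sets_def)
  show "b p \<subseteq> interpolant x"
    using thicken_subset_interpolant[OF p(1), of x] subset_thicken[of 0 "b p"] p(2) gap by auto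
  show "interpolant x \<subseteq> b p"
  proof (rule interpolant_subset)
    fix q assume q: "q \<in> P" "2 * D x q \<le> 6 * gap x"
    then have D: "D x q = 0"
      using D_nonneg[OF x q(1)] gap by simp
    have "thicken (b q) 0 \<subseteq> thicken (thicken (b p) 0) 0"
      using b_subset_thicken[OF x q(1) p(1)] D p(2) by (intro thicken_mono) auto
    also have "\<dots> = b p"
      by (simp add: thicken_def)
    finally show "thicken (b q) (6 * gap x - 2 * D x q) \<subseteq> b p"
      using D gap by simp
  qed (use b in \<open>auto intro: compact_imp_closed\<close>)
qed

text \<open>A positive gap gives the nearest piece a positive radius.\<close>

lemma interpolant_cases:
  assumes x: "x \<in> X"
  obtains p where "p \<in> P" "interpolant x = b p" | "interior (interpolant x) \<noteq> {}"
proof -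
  obtain p where p: "p \<in> P" "D x p = gap x" "0 \<le> gap x"
    using gap_attained[OF x] by metis
  show thesis
  proof (cases "gap x = 0")
    case True
    then show ?thesis
      using that(1) interpolant_eq[OF x] p by simp
  next
    case False
    obtain a where a: "a \<in> b p"
      using b_in[OF p(1)] by (auto simp: compact_convex_sets_def)
    have "ball a (4 * gap x) \<subseteq> thicken (b p) (4 * gap x)"
      using a by (auto simp: thicken_def dist_commute intro!: bexI[of _ a])
    also have "\<dots> \<subseteq> interpolant x"
      using thicken_subset_interpolant[OF p(1), of x] p by simp
    finally have "ball a (4 * gap x) \<subseteq> interior (interpolant x)"
      by (simp add: interior_maximal)
    then show ?thesis
      using that(2) False p(3) by fastforce
  qed
qed

lemma interpolant_isometry_image:
  assumes h: "orthogonal_transformation h" and \<pi>: "\<pi> ` P = P"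
    and inv: "\<And>p. p \<in> P \<Longrightarrow> D y (\<pi> p) = D x p" "\<And>p. p \<in> P \<Longrightarrow> b (\<pi> p) = h ` b p"
  shows "interpolant y = h ` interpolant x"
proof -
  note lin = orthogonal_transformation_linear[OF h]
  have "D y ` P = (D y \<circ> \<pi>) ` P"
    using \<pi> by (metis image_comp)
  also have "\<dots> = D x ` P"
    by (rule image_cong) (auto simp: inv)
  finally have gap: "gap y = gap x"
    by (simp add: gap_def)
  have "pieces y = (\<Union>p\<in>\<pi> ` P. thicken (b p) (6 * gap y - 2 * D y p))"
    by (simp add: pieces_def \<pi>)
  also have "\<dots> = h ` pieces x"
    by (simp add: pieces_def inv gap thicken_isometry_image[OF h] image_UN)
  finally have "convex hull pieces y = h ` (convex hull pieces x)"
    by (simp add: convex_hull_linear_image[OF lin])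
  then show ?thesis
    unfolding interpolant_def
    by (simp add: closure_injective_linear_image[OF lin orthogonal_transformation_inj[OF h]])
qed

end

section \<open>Extension of functions with compact graph\<close>

abbreviation hyperspace :: "'a::euclidean_space set topology"
  where "hyperspace \<equiv> Metric_space.mtopology compact_convex_sets hausdorff_dist"

lemma topspace_hyperspace [simp]: "topspace hyperspace = compact_convex_sets"
  by (rule Metric_space.topspace_mtopology[OF Metric_space_hausdorff])

lemma continuous_map_hausdorff_dist:
  assumes "continuous_map Z hyperspace f" "continuous_map Z hyperspace g"
  shows "continuous_map Z euclideanreal (\<lambda>z. hausdorff_dist (f z) (g z))"
proof -
  have "continuous_map (prod_topology hyperspace hyperspace) euclideanreal
      (\<lambda>(x, y). hausdorff_dist x y :: real)"
    using continuous_map_metric[of "metric (compact_convex_sets, hausdorff_dist)"]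
    by (simp add: mtopology_of_def Metric_space.mspace_metric[OF Metric_space_hausdorff]
        Metric_space.mdist_metric[OF Metric_space_hausdorff])
  from continuous_map_compose[OF continuous_map_pairedI[OF assms] this] show ?thesis
    by (simp add: o_def)
qed

lemma hausdorff_dist_isometry_image:
  fixes h :: "'a::euclidean_space \<Rightarrow> 'a"
  assumes h: "orthogonal_transformation h" and "A \<in> compact_convex_sets" "B \<in> compact_convex_sets"
  shows "h ` A \<in> compact_convex_sets" and "hausdorff_dist (h ` A) (h ` B) = hausdorff_dist A B"
proof -
  note lin = orthogonal_transformation_linear[OF h] and inj = orthogonal_transformation_inj[OF h]
  have in_ccs: "h ` C \<in> compact_convex_sets" if "C \<in> compact_convex_sets" for C
    using that lin
    by (auto simp: compact_convex_sets_def convex_linear_image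
        intro!: compact_continuous_image linear_continuous_on linear_conv_bounded_linear[THEN iffD1])
  then show "h ` A \<in> compact_convex_sets"
    using assms by blast
  have "hausdorff_dist (h ` A) (h ` B) \<le> e \<longleftrightarrow> hausdorff_dist A B \<le> e" for e
    using assms in_ccs by (simp add: hausdorff_dist_le_iff_thicken thicken_isometry_image[OF h]
        inj_image_subset_iff[OF inj])
  from this[of "hausdorff_dist (h ` A) (h ` B)"] this[of "hausdorff_dist A B"]
  show "hausdorff_dist (h ` A) (h ` B) = hausdorff_dist A B"
    by simp
qed

text \<open>
  Describing the function by its graph \<open>P\<close> makes its continuity automatic (the first projection is a
  homeomorphism onto its compact image) and states its symmetries as invariance of a set. The modulus \<open>\<omega>\<close>
  satisfies \<open>hausdorff_dist (snd p) (snd q) \<le> \<omega> (hausdorff_dist (fst p) (fst q))\<close> on \<open>P\<close>, so the nodes \<open>P\<close> with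
  values \<open>snd\<close> can be interpolated with \<open>D A p = \<omega> (hausdorff_dist A (fst p))\<close>; the interpolant is continuous
  because \<open>D\<close> changes by at most \<open>\<omega> (hausdorff_dist A B)\<close> from \<open>A\<close> to \<open>B\<close>, uniformly in the node.
\<close>

theorem equivariant_extension_of_compact_graph:
  fixes P :: "('a::euclidean_space set \<times> 'a set) set"
  assumes comp: "compactin (prod_topology hyperspace hyperspace) P" and "P \<noteq> {}"
    and single: "\<And>A B B'. (A, B) \<in> P \<Longrightarrow> (A, B') \<in> P \<Longrightarrow> B = B'"
  obtains F :: "'a set \<Rightarrow> 'a set" where "continuous_map hyperspace hyperspace F"
    and "\<And>A B. (A, B) \<in> P \<Longrightarrow> F A = B"
    and "\<And>A. A \<in> compact_convex_sets \<Longrightarrow> F A \<in> snd ` P \<or> interior (F A) \<noteq> {}"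
    and "\<And>h A. orthogonal_transformation h \<Longrightarrow> map_prod ((`) h) ((`) h) ` P = P \<Longrightarrow>
      A \<in> compact_convex_sets \<Longrightarrow> F (h ` A) = h ` F A"
proof -
  interpret H: Metric_space "compact_convex_sets :: 'a set set" hausdorff_dist
    by (rule Metric_space_hausdorff)
  define Q where "Q = subtopology (prod_topology hyperspace hyperspace) P"
  have P: "fst p \<in> compact_convex_sets" "snd p \<in> compact_convex_sets" if "p \<in> P" for p
    using compactin_subset_topspace[OF comp] that by auto
  have Q: "compact_space Q" "topspace Q = P"
    using comp compactin_subset_topspace[OF comp]
    by (auto simp: Q_def compact_space_subtopology)
  have cont: "continuous_map Q hyperspace fst" "continuous_map Q hyperspace snd"
    unfolding Q_def by (auto intro!: continuous_map_from_subtopology continuous_map_fst continuous_map_snd)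
  define \<alpha> where "\<alpha> = (\<lambda>(p :: 'a set \<times> 'a set, q :: 'a set \<times> 'a set). hausdorff_dist (fst p) (fst q))"
  define \<beta> where "\<beta> = (\<lambda>(p :: 'a set \<times> 'a set, q :: 'a set \<times> 'a set). hausdorff_dist (snd p) (snd q))"
  have control: "\<exists>c\<ge>0. \<forall>z\<in>P \<times> P. \<beta> z \<le> e + c * \<alpha> z" if "e > 0" for e
  proof -
    have "\<exists>c\<ge>0. \<forall>z\<in>topspace (prod_topology Q Q). \<beta> z \<le> e + c * \<alpha> z"
    proof (rule compact_linear_control)
      show "compact_space (prod_topology Q Q)"
        using Q by (simp add: compact_space_prod_topology)
      show "continuous_map (prod_topology Q Q) euclideanreal \<alpha>"
        unfolding \<alpha>_def case_prod_unfold
        by (intro continuous_map_hausdorff_dist continuous_map_compose[OF continuous_map_fst cont(1), unfolded o_def]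
            continuous_map_compose[OF continuous_map_snd cont(1), unfolded o_def])
      show "continuous_map (prod_topology Q Q) euclideanreal \<beta>"
        unfolding \<beta>_def case_prod_unfold
        by (intro continuous_map_hausdorff_dist continuous_map_compose[OF continuous_map_fst cont(2), unfolded o_def]
            continuous_map_compose[OF continuous_map_snd cont(2), unfolded o_def])
      fix z assume "z \<in> topspace (prod_topology Q Q)"
      then obtain p q where z: "z = (p, q)" "p \<in> P" "q \<in> P"
        using Q by auto
      then show "0 \<le> \<alpha> z"
        by (simp add: \<alpha>_def)
      assume "\<alpha> z = 0"
      then have "fst p = fst q"
        using z P by (simp add: \<alpha>_def)
      then have "snd p = snd q"
        using single z by (metis prod.collapse)
      then show "\<beta> z \<le> 0"
        using z P by (simp add: \<beta>_def)
    qed (fact that)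
    then show ?thesis
      using Q by simp
  qed
  obtain \<omega> where \<omega>: "\<omega> 0 = 0" "\<And>s t. 0 \<le> s \<Longrightarrow> s \<le> t \<Longrightarrow> \<omega> s \<le> \<omega> t"
    "\<And>s t. 0 \<le> s \<Longrightarrow> 0 \<le> t \<Longrightarrow> \<omega> (s + t) \<le> \<omega> s + \<omega> t" "\<And>e. e > 0 \<Longrightarrow> \<exists>d>0. \<omega> d < e"
    "\<And>z. z \<in> P \<times> P \<Longrightarrow> \<beta> z \<le> \<omega> (\<alpha> z)"
    by (rule subadditive_modulus_exists[of "P \<times> P" \<alpha> \<beta>, OF _ _ control])
      (simp_all add: \<alpha>_def \<beta>_def split: prod.splits)
  define D where "D = (\<lambda>A (p :: 'a set \<times> 'a set). \<omega> (hausdorff_dist A (fst p)))"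
  have tri: "\<omega> (hausdorff_dist A C) \<le> \<omega> (hausdorff_dist A B) + \<omega> (hausdorff_dist B C)"
    if "A \<in> compact_convex_sets" "B \<in> compact_convex_sets" "C \<in> compact_convex_sets" for A B C :: "'a set"
  proof -
    have "\<omega> (hausdorff_dist A C) \<le> \<omega> (hausdorff_dist A B + hausdorff_dist B C)"
      using H.triangle that by (intro \<omega>(2)) auto
    also have "\<dots> \<le> \<omega> (hausdorff_dist A B) + \<omega> (hausdorff_dist B C)"
      by (intro \<omega>(3)) auto
    finally show ?thesis .
  qed
  interpret I: convex_set_interpolation compact_convex_sets P D snd
  proof
    fix A p assume A: "A \<in> (compact_convex_sets :: 'a set set)"
    have "continuous_map Q euclideanreal (\<lambda>p. hausdorff_dist A (fst p))"
      using A by (intro continuous_map_hausdorff_dist cont) auto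
    then have "compact ((\<lambda>p. hausdorff_dist A (fst p)) ` P)"
      using image_compactin[of Q P euclideanreal] Q by (simp add: compact_space_def)
    then obtain p' where "p' \<in> P" "\<And>q. q \<in> P \<Longrightarrow> hausdorff_dist A (fst p') \<le> hausdorff_dist A (fst q)"
      using compact_attains_inf[of "(\<lambda>p. hausdorff_dist A (fst p)) ` P"] \<open>P \<noteq> {}\<close> by auto
    then show "\<exists>p\<in>P. \<forall>q\<in>P. D A p \<le> D A q"
      unfolding D_def using \<omega>(2) by (intro bexI[of _ p']) auto
    show "0 \<le> D A p"
      using \<omega>(2)[of 0 "hausdorff_dist A (fst p)"] \<omega>(1) by (simp add: D_def)
    fix q assume "p \<in> P" "q \<in> P"
    then show "hausdorff_dist (snd p) (snd q) \<le> D A p + D A q"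
      using \<omega>(5)[of "(p, q)"] tri[of "fst p" A "fst q"] P A
      by (auto simp: \<alpha>_def \<beta>_def D_def H.commute)
  qed (use P in auto)
  show thesis
  proof
    show "continuous_map hyperspace hyperspace I.interpolant"
      unfolding H.metric_continuous_map[OF Metric_space_hausdorff]
    proof (intro conjI ballI allI impI)
      fix A :: "'a set" and e :: real assume A: "A \<in> compact_convex_sets" and "e > 0"
      then obtain d where d: "d > 0" "\<omega> d < e / 12"
        using \<omega>(4)[of "e / 12"] by auto
      have "hausdorff_dist (I.interpolant A) (I.interpolant B) < e"
        if B: "B \<in> compact_convex_sets" "hausdorff_dist A B < d" for B
      proof -
        have "hausdorff_dist (I.interpolant A) (I.interpolant B) \<le> 12 * \<omega> (hausdorff_dist A B)"
        proof (rule I.hausdorff_dist_interpolant[OF A B(1)])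
          fix p assume "p \<in> P"
          then show "\<bar>D A p - D B p\<bar> \<le> \<omega> (hausdorff_dist A B)"
            using tri[of A B "fst p"] tri[of B A "fst p"] A B P by (simp add: D_def H.commute)
        qed
        also have "\<dots> \<le> 12 * \<omega> d"
          using \<omega>(2)[of "hausdorff_dist A B" d] B by simp
        finally show ?thesis
          using d by simp
      qed
      then show "\<exists>d>0. \<forall>B. B \<in> compact_convex_sets \<and> hausdorff_dist A B < d \<longrightarrow>
          hausdorff_dist (I.interpolant A) (I.interpolant B) < e"
        using d(1) by blast
    qed (use I.interpolant_in in auto)
    show "I.interpolant A = B" if "(A, B) \<in> P" for A B
      using I.interpolant_eq[of A "(A, B)"] P[OF that] that \<omega>(1) by (simp add: D_def)
    show "I.interpolant A \<in> snd ` P \<or> interior (I.interpolant A) \<noteq> {}" if "A \<in> compact_convex_sets" for A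
      using I.interpolant_cases[OF that] by (metis imageI)
    show "I.interpolant (h ` A) = h ` I.interpolant A"
      if h: "orthogonal_transformation h" "map_prod ((`) h) ((`) h) ` P = P" and A: "A \<in> compact_convex_sets" for h A
      by (rule I.interpolant_isometry_image[OF h])
        (use P in \<open>auto simp: D_def hausdorff_dist_isometry_image[OF h(1) A]\<close>)
  qed
qed

section \<open>The circumscribed ball\<close>

lemma singleton_in_compact_convex_sets [simp]: "{x} \<in> compact_convex_sets"
  by (simp add: compact_convex_sets_def)

lemma hausdorff_dist_singleton_le_iff:
  assumes "K \<in> compact_convex_sets"
  shows "hausdorff_dist {x} K \<le> e \<longleftrightarrow> K \<subseteq> cball x e"
proof -
  have "K \<noteq> {}"
    using assms by (simp add: compact_convex_sets_def)
  then show ?thesis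
    using hausdorff_dist_le_iff[OF singleton_in_compact_convex_sets assms, of x e]
    by (auto simp: dist_commute)
qed

text \<open>
  The distance \<open>hausdorff_dist {x} K\<close> is the radius of the smallest ball around \<open>x\<close> that contains \<open>K\<close>. So the
  circumscribed ball is the best approximation of \<open>K\<close> by a singleton, and the triangle inequality of the
  Hausdorff metric gives the Lipschitz estimates for it.
\<close>

definition circumradius :: "'a::euclidean_space set \<Rightarrow> real"
  where "circumradius K = (INF x. hausdorff_dist {x} K)"

definition circumcenter :: "'a::euclidean_space set \<Rightarrow> 'a"
  where "circumcenter K = (SOME x. hausdorff_dist {x} K = circumradius K)"

lemma circumradius_le: "circumradius K \<le> hausdorff_dist {x} K"
  unfolding circumradius_def
  by (rule cINF_lower) (auto intro: bdd_belowI2 hausdorff_dist_nonneg)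

lemma circumradius_nonneg: "0 \<le> circumradius K"
  unfolding circumradius_def by (rule cINF_greatest) (auto intro: hausdorff_dist_nonneg)

lemma hausdorff_dist_triangle:
  "A \<in> compact_convex_sets \<Longrightarrow> B \<in> compact_convex_sets \<Longrightarrow> C \<in> compact_convex_sets \<Longrightarrow>
    hausdorff_dist A C \<le> hausdorff_dist A B + hausdorff_dist B C"
  by (rule Metric_space.triangle[OF Metric_space_hausdorff])

lemma hausdorff_dist_commute:
  fixes A B :: "'a::euclidean_space set"
  shows "hausdorff_dist A B = hausdorff_dist B A"
  by (rule Metric_space.commute[OF Metric_space_hausdorff])

lemma hausdorff_dist_singletons:
  fixes x y :: "'a::euclidean_space"
  shows "hausdorff_dist {x} {y} = dist x y"
proof -
  have "hausdorff_dist {x} {y} \<le> e \<longleftrightarrow> dist x y \<le> e" for e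
    by (simp add: hausdorff_dist_singleton_le_iff)
  then show ?thesis
    by (metis order_antisym order_refl)
qed

text \<open>Only centres \<open>x\<close> in a compact ball around a point \<open>k\<close> of \<open>K\<close> compete with the centre \<open>k\<close>, so
  the infimum is attained.\<close>

lemma hausdorff_dist_circumcenter:
  assumes K: "K \<in> compact_convex_sets"
  shows "hausdorff_dist {circumcenter K} K = circumradius K"
proof -
  obtain k where k: "k \<in> K"
    using K by (auto simp: compact_convex_sets_def)
  let ?r = "hausdorff_dist {k} K"
  have "\<bar>hausdorff_dist {x} K - hausdorff_dist {y} K\<bar> \<le> dist x y" for x y
    using hausdorff_dist_triangle[of "{x}" "{y}" K] hausdorff_dist_triangle[of "{y}" "{x}" K] K
    by (simp add: hausdorff_dist_singletons dist_commute)
  then have "continuous_on S (\<lambda>x. hausdorff_dist {x} K)" for S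
    unfolding continuous_on_iff dist_real_def by (meson dist_commute_lessI le_less_trans)
  then obtain x where x: "\<And>y. y \<in> cball k ?r \<Longrightarrow> hausdorff_dist {x} K \<le> hausdorff_dist {y} K"
    using continuous_attains_inf[OF compact_cball, of k ?r "\<lambda>x. hausdorff_dist {x} K"]
      hausdorff_dist_nonneg[of "{k}" K] by fastforce
  have "hausdorff_dist {x} K \<le> hausdorff_dist {y} K" for y
  proof (cases "y \<in> cball k ?r")
    case False
    have "hausdorff_dist {x} K \<le> ?r"
      by (rule x) (simp add: hausdorff_dist_nonneg)
    also have "\<dots> \<le> dist y k"
      using False by (simp add: dist_commute)
    also have "\<dots> \<le> hausdorff_dist {y} K"
      using hausdorff_dist_singleton_le_iff[OF K, of y "hausdorff_dist {y} K"] k by auto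
    finally show ?thesis .
  qed (rule x)
  then have "hausdorff_dist {x} K = circumradius K"
    unfolding circumradius_def by (intro cInf_eq_minimum[symmetric]) auto
  then show ?thesis
    unfolding circumcenter_def by (rule someI)
qed

text \<open>If balls of radius \<open>s\<close> around two points \<open>x\<close> and \<open>y\<close> contain \<open>K\<close>, then, by the
  parallelogram identity, so does a ball around the midpoint whose squared radius is smaller by
  \<open>(dist x y)\<^sup>2 / 4\<close>. This gives both uniqueness and continuity of the centre.\<close>

lemma circumcenter_stable:
  assumes K: "K \<in> compact_convex_sets" and xy: "K \<subseteq> cball x s" "K \<subseteq> cball y s"
  shows "(dist x y)\<^sup>2 \<le> 4 * (s\<^sup>2 - (circumradius K)\<^sup>2)"
proof -
  define z where "z = (1/2) *\<^sub>R (x + y)"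
  define q where "q = s\<^sup>2 - (dist x y)\<^sup>2 / 4"
  have q: "(dist z k)\<^sup>2 \<le> q" if "k \<in> K" for k
  proof -
    have "dist x k \<le> s" "dist y k \<le> s"
      using xy that by auto
    then have "(dist x k)\<^sup>2 \<le> s\<^sup>2" "(dist y k)\<^sup>2 \<le> s\<^sup>2"
      by (auto intro: power_mono)
    moreover have "(dist z k)\<^sup>2 = ((dist x k)\<^sup>2 + (dist y k)\<^sup>2) / 2 - (dist x y)\<^sup>2 / 4"
      unfolding z_def dist_norm power2_norm_eq_inner
      by (simp add: inner_simps inner_commute field_simps)
    ultimately show ?thesis
      by (simp add: q_def)
  qed
  obtain k where k: "k \<in> K"
    using K by (auto simp: compact_convex_sets_def)
  have "0 \<le> q"
    using q[OF k] by (meson order_trans zero_le_power2)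
  have "K \<subseteq> cball z (sqrt q)"
    using q by (auto simp: real_le_rsqrt)
  then have "circumradius K \<le> sqrt q"
    using circumradius_le[of K z] hausdorff_dist_singleton_le_iff[OF K, of z] by (meson order_trans)
  then have "(circumradius K)\<^sup>2 \<le> (sqrt q)\<^sup>2"
    by (rule power_mono[OF _ circumradius_nonneg])
  then show ?thesis
    using \<open>0 \<le> q\<close> by (simp add: q_def)
qed

lemma circumball:
  assumes "K \<in> compact_convex_sets"
  shows "K \<subseteq> cball (circumcenter K) (circumradius K)"
  using hausdorff_dist_circumcenter[OF assms] hausdorff_dist_singleton_le_iff[OF assms]
  by (metis order_refl)

lemma circumcenter_unique:
  assumes "K \<in> compact_convex_sets" "K \<subseteq> cball x (circumradius K)"
  shows "circumcenter K = x"
  using circumcenter_stable[OF assms(1) circumball[OF assms(1)] assms(2)] by simp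

lemma circumradius_lipschitz:
  assumes "K \<in> compact_convex_sets" "L \<in> compact_convex_sets"
  shows "\<bar>circumradius K - circumradius L\<bar> \<le> hausdorff_dist K L"
proof -
  have "circumradius K \<le> circumradius L + hausdorff_dist K L"
    if "K \<in> compact_convex_sets" "L \<in> compact_convex_sets" for K L :: "'a set"
    using circumradius_le[of K "circumcenter L"] hausdorff_dist_circumcenter[OF that(2)]
      hausdorff_dist_triangle[OF _ that(2,1), of "{circumcenter L}"]
    by (simp add: hausdorff_dist_commute)
  from this[OF assms] this[OF assms(2,1)] show ?thesis
    by (simp add: hausdorff_dist_commute abs_le_iff)
qed

text \<open>With \<open>R\<close> the circumradius of \<open>K\<close>, the balls of radius \<open>R + 2 * d\<close> around both centres contain \<open>K\<close>.\<close>

lemma dist_circumcenter_le: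
  assumes K: "K \<in> compact_convex_sets" and L: "L \<in> compact_convex_sets"
    and d: "hausdorff_dist K L \<le> d"
  shows "(dist (circumcenter K) (circumcenter L))\<^sup>2 \<le> 16 * d * (circumradius K + d)"
proof -
  have d0: "0 \<le> d"
    using d hausdorff_dist_nonneg[of K L] by linarith
  have "hausdorff_dist {circumcenter L} K \<le> circumradius L + hausdorff_dist K L"
    using hausdorff_dist_circumcenter[OF L] hausdorff_dist_triangle[OF _ L K, of "{circumcenter L}"]
    by (simp add: hausdorff_dist_commute)
  also have "\<dots> \<le> circumradius K + 2 * d"
    using circumradius_lipschitz[OF K L] d by linarith
  finally have "K \<subseteq> cball (circumcenter L) (circumradius K + 2 * d)"
    by (simp add: hausdorff_dist_singleton_le_iff[OF K])
  moreover have "K \<subseteq> cball (circumcenter K) (circumradius K + 2 * d)"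
    using circumball[OF K] d0 by (auto intro: order_trans)
  ultimately have "(dist (circumcenter K) (circumcenter L))\<^sup>2
      \<le> 4 * ((circumradius K + 2 * d)\<^sup>2 - (circumradius K)\<^sup>2)"
    by (intro circumcenter_stable[OF K])
  also have "\<dots> = 16 * d * (circumradius K + d)"
    by (simp add: power2_eq_square algebra_simps)
  finally show ?thesis .
qed

lemma continuous_map_from_hyperspace:
  fixes f :: "'a::euclidean_space set \<Rightarrow> 'b::metric_space"
  assumes "\<And>K e. K \<in> compact_convex_sets \<Longrightarrow> e > 0 \<Longrightarrow>
    \<exists>d>0. \<forall>L\<in>compact_convex_sets. hausdorff_dist K L < d \<longrightarrow> dist (f K) (f L) < e"
  shows "continuous_map hyperspace euclidean f"
  unfolding mtopology_is_euclidean[symmetric]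
    Metric_space.metric_continuous_map[OF Metric_space_hausdorff Met_TC.Metric_space_axioms]
  using assms by blast

lemma continuous_map_circumradius:
  "continuous_map hyperspace euclideanreal (circumradius :: 'a::euclidean_space set \<Rightarrow> real)"
proof (rule continuous_map_from_hyperspace)
  fix K :: "'a set" and e :: real assume "K \<in> compact_convex_sets" "e > 0"
  then show "\<exists>d>0. \<forall>L\<in>compact_convex_sets. hausdorff_dist K L < d \<longrightarrow>
      dist (circumradius K) (circumradius L) < e"
    using circumradius_lipschitz[of K] le_less_trans unfolding dist_real_def by blast
qed

lemma continuous_map_circumcenter:
  "continuous_map hyperspace euclidean (circumcenter :: 'a::euclidean_space set \<Rightarrow> 'a)"
proof (rule continuous_map_from_hyperspace)
  fix K :: "'a set" and e :: real assume K: "K \<in> compact_convex_sets" and e: "e > 0"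
  have "((\<lambda>d. 16 * d * (circumradius K + d)) \<longlongrightarrow> 16 * 0 * (circumradius K + 0)) (at_right 0)"
    by (intro tendsto_intros)
  then have "\<forall>\<^sub>F d in at_right 0. 16 * d * (circumradius K + d) < e\<^sup>2"
    using e by (auto intro: order_tendstoD(2))
  then have "\<exists>d0>0. \<forall>d>0. d < d0 \<longrightarrow> 16 * d * (circumradius K + d) < e\<^sup>2"
    by (simp add: eventually_at_right_field)
  then obtain d where d: "d > 0" "16 * d * (circumradius K + d) < e\<^sup>2"
    using dense by blast
  have "dist (circumcenter K) (circumcenter L) < e"
    if "L \<in> compact_convex_sets" "hausdorff_dist K L < d" for L
  proof (rule power_less_imp_less_base)
    show "(dist (circumcenter K) (circumcenter L))\<^sup>2 < e\<^sup>2"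
      using dist_circumcenter_le[OF K that(1), of d] that(2) d by linarith
  qed (use e in auto)
  then show "\<exists>d>0. \<forall>L\<in>compact_convex_sets. hausdorff_dist K L < d \<longrightarrow>
      dist (circumcenter K) (circumcenter L) < e"
    using d(1) by blast
qed

lemma circumradius_pos:
  assumes "K \<in> compact_convex_sets" "aff_dim K \<ge> 1"
  shows "0 < circumradius K"
proof (rule ccontr)
  assume "\<not> 0 < circumradius K"
  then have "circumradius K = 0"
    using circumradius_nonneg[of K] by linarith
  then have "K \<subseteq> {circumcenter K}"
    using circumball[OF assms(1)] by simp
  then have "aff_dim K \<le> 0"
    using aff_dim_subset[of K "{circumcenter K}"] by simp
  then show False
    using assms(2) by simp
qed

lemma similarity_image_cball_subset_iff:
  assumes "(u, r, A) \<in> similarity_params"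
  shows "similarity (u, r, A) ` K \<subseteq> cball (similarity (u, r, A) x) (r * s) \<longleftrightarrow> K \<subseteq> cball x s"
proof -
  have r: "r > 0" "orthogonal_matrix A"
    using assms by (auto simp: similarity_params_def)
  have "dist (similarity (u, r, A) x) (similarity (u, r, A) y) = r * dist x y" for y
  proof -
    have "similarity (u, r, A) x - similarity (u, r, A) y = r *\<^sub>R (A *v (x - y))"
      by (simp add: similarity_apply matrix_vector_mult_diff_distrib scaleR_diff_right)
    then show ?thesis
      using r by (simp add: dist_norm norm_orthogonal_matrix_mult)
  qed
  then show ?thesis
    using r by auto
qed

lemma compact_convex_dim_ge_0: "compact_convex_dim_ge 0 = compact_convex_sets"
proof -
  have "aff_dim K \<ge> 0" if "K \<noteq> {}" for K :: "'a set"
    using that aff_dim_geq[of K] aff_dim_empty[of K] by linarith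
  then show ?thesis
    by (auto simp: compact_convex_dim_ge_def compact_convex_sets_def)
qed

lemma circumball_similarity_image:
  assumes K: "K \<in> compact_convex_sets" and p: "(u, r, A) \<in> similarity_params"
  shows "circumradius (similarity (u, r, A) ` K) = r * circumradius K"
    and "circumcenter (similarity (u, r, A) ` K) = similarity (u, r, A) (circumcenter K)"
proof -
  let ?g = "similarity (u, r, A)"
  have r: "r > 0"
    using p by (auto simp: similarity_params_def)
  have g: "?g \<in> carrier similarity_group"
    using p by (simp add: carrier_similarity_group)
  have gK: "?g ` K \<in> compact_convex_sets"
    using similarity_image_in[OF g, of K 0] K by (simp add: compact_convex_dim_ge_0)
  have inv: "similarity (params_inv (u, r, A)) (?g x) = x" "?g (similarity (params_inv (u, r, A)) x) = x" for x
    using inv_similarity[OF p] group.l_inv[OF group_similarity_group g] group.r_inv[OF group_similarity_group g]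
    by (simp_all add: similarity_group_def fun_eq_iff)
  have "circumradius (?g ` K) \<le> r * circumradius K"
    using circumradius_le[of "?g ` K" "?g (circumcenter K)"] hausdorff_dist_singleton_le_iff[OF gK]
      similarity_image_cball_subset_iff[OF p] circumball[OF K] by (meson order_trans)
  moreover have "r * circumradius K \<le> circumradius (?g ` K)"
  proof -
    define x where "x = similarity (params_inv (u, r, A)) (circumcenter (?g ` K))"
    have "?g ` K \<subseteq> cball (?g x) (r * (circumradius (?g ` K) / r))"
      using circumball[OF gK] r inv by (simp add: x_def)
    then have "K \<subseteq> cball x (circumradius (?g ` K) / r)"
      by (simp only: similarity_image_cball_subset_iff[OF p])
    then have "circumradius K \<le> circumradius (?g ` K) / r"
      using circumradius_le[of K x] hausdorff_dist_singleton_le_iff[OF K] by (meson order_trans)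
    then show ?thesis
      using r by (simp add: field_simps)
  qed
  ultimately show rad: "circumradius (?g ` K) = r * circumradius K"
    by simp
  show "circumcenter (?g ` K) = ?g (circumcenter K)"
    by (rule circumcenter_unique[OF gK])
      (simp add: rad similarity_image_cball_subset_iff[OF p] circumball[OF K])
qed

section \<open>Frames and shapes\<close>

abbreviation rotation :: "real^'n^'n \<Rightarrow> real^'n \<Rightarrow> real^'n"
  where "rotation A \<equiv> similarity (0, 1, A)"

abbreviation similarity_inv :: "(real^'n \<Rightarrow> real^'n) \<Rightarrow> real^'n \<Rightarrow> real^'n"
  where "similarity_inv g \<equiv> inv\<^bsub>similarity_group\<^esub> g"

lemma similarity_inv_in:
  "g \<in> carrier similarity_group \<Longrightarrow> similarity_inv g \<in> carrier similarity_group"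
  by (rule group.inv_closed[OF group_similarity_group])

lemma similarity_comp_in:
  "g \<in> carrier similarity_group \<Longrightarrow> h \<in> carrier similarity_group \<Longrightarrow> g \<circ> h \<in> carrier similarity_group"
  using monoid.m_closed[OF group.is_monoid[OF group_similarity_group], of g h]
  by (simp add: similarity_group_def)

lemma similarity_inv_image [simp]:
  assumes "g \<in> carrier similarity_group"
  shows "g ` similarity_inv g ` K = K" and "similarity_inv g ` g ` K = K"
  using group.l_inv[OF group_similarity_group assms] group.r_inv[OF group_similarity_group assms]
  by (simp_all add: similarity_group_def image_comp)

lemma rotation_in: "orthogonal_matrix A \<Longrightarrow> rotation A \<in> carrier similarity_group"
  by (simp add: carrier_similarity_group similarity_params_def)

lemma orthogonal_transformation_rotation:
  "orthogonal_matrix A \<Longrightarrow> orthogonal_transformation (rotation A)"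
proof -
  have "rotation A = (*v) A"
    by (simp add: fun_eq_iff similarity_apply)
  then show "orthogonal_matrix A \<Longrightarrow> orthogonal_transformation (rotation A)"
    by (simp add: orthogonal_transformation_matrix)
qed

lemma rotation_comp: "rotation A \<circ> rotation B = rotation (A ** B)"
  by (simp add: similarity_comp params_mult_def)

text \<open>Boundedness holds because the rows of an orthogonal matrix are unit vectors.\<close>

lemma compact_orthogonal_matrices: "compact {A :: real^'n^'n. orthogonal_matrix A}"
proof -
  have "norm A \<le> CARD('n)" if "orthogonal_matrix A" for A :: "real^'n^'n"
  proof -
    have "norm (A $ i) = 1" for i
      using that by (auto simp: orthogonal_matrix_orthonormal_rows row_def vec_lambda_eta)
    then have "L2_set (\<lambda>i. norm (A $ i)) UNIV \<le> (\<Sum>i\<in>(UNIV::'n set). 1)"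
      using L2_set_le_sum[of UNIV "\<lambda>i. norm (A $ i)"] by simp
    then show ?thesis
      by (simp add: norm_vec_def)
  qed
  then have "bounded {A :: real^'n^'n. orthogonal_matrix A}"
    by (auto intro: boundedI)
  moreover have "closed {A :: real^'n^'n. orthogonal_matrix A}"
    unfolding orthogonal_matrix_def
    by (intro closed_Collect_conj closed_Collect_eq continuous_on_matrix_mult
        continuous_on_matrix_transpose continuous_on_id continuous_on_const)
  ultimately show ?thesis
    by (simp add: compact_eq_bounded_closed)
qed

lemma continuous_map_rotation_image:
  assumes "B \<in> compact_convex_sets"
  shows "continuous_map (top_of_set {A. orthogonal_matrix A}) hyperspace (\<lambda>A. rotation A ` B)"
proof -
  interpret G: G_space similarity_group similarity_topology "hausdorff_topology 0" "image_action 0"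
    by (rule G_space_compact_convex_sets)
  have "continuous_map (top_of_set {A. orthogonal_matrix A}) similarity_topology rotation"
  proof (rule continuous_map_compose[OF _ continuous_map_similarity, unfolded o_def])
    show "continuous_map (top_of_set {A. orthogonal_matrix A}) (top_of_set similarity_params) (\<lambda>A. (0, 1, A))"
      by (auto simp: similarity_params_def intro!: continuous_intros)
  qed
  then have "continuous_map (top_of_set {A. orthogonal_matrix A})
      (prod_topology similarity_topology (hausdorff_topology 0)) (\<lambda>A. (rotation A, B))"
    using assms by (intro continuous_map_pairedI) (auto simp: compact_convex_dim_ge_0)
  from continuous_map_compose[OF this G.continuous_action]
  have "continuous_map (top_of_set {A. orthogonal_matrix A}) (hausdorff_topology 0) (\<lambda>A. rotation A ` B)"
    using assms by (simp add: o_def image_action_def compact_convex_dim_ge_0)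
  then show ?thesis
    by (simp add: hausdorff_topology_def continuous_map_in_subtopology)
qed

definition frame :: "(real^'n) set \<Rightarrow> real^'n \<Rightarrow> real^'n"
  where "frame K = similarity (circumcenter K, circumradius K, mat 1)"

lemma frame_params_in:
  assumes "1 \<le> i" "K \<in> compact_convex_dim_ge i"
  shows "(circumcenter K, circumradius K, mat 1) \<in> similarity_params"
proof -
  have "0 < circumradius K"
    using assms by (intro circumradius_pos) (auto simp: compact_convex_dim_ge_def)
  then show ?thesis
    by (simp add: similarity_params_def orthogonal_matrix_id)
qed

lemma frame_in:
  "1 \<le> i \<Longrightarrow> K \<in> compact_convex_dim_ge i \<Longrightarrow> frame K \<in> carrier similarity_group"
  using frame_params_in by (auto simp: frame_def carrier_similarity_group)

text \<open>The frame has no rotation part, so it is equivariant only up to the rotation part of the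
  similarity; that is why the symmetry group of shapes is the orthogonal group and not trivial.\<close>

lemma frame_similarity_image:
  assumes "K \<in> compact_convex_sets" "(u, r, A) \<in> similarity_params"
  shows "frame (similarity (u, r, A) ` K) \<circ> rotation A = similarity (u, r, A) \<circ> frame K"
  unfolding frame_def circumball_similarity_image[OF assms]
  by (simp add: fun_eq_iff similarity_apply matrix_vector_right_distrib scaleR_add_right matrix_vector_mult_scaleR)

lemma continuous_map_frame:
  assumes "1 \<le> i"
  shows "continuous_map (hausdorff_topology i) similarity_topology (frame :: (real^'n) set \<Rightarrow> _)"
  unfolding frame_def
proof (rule continuous_map_compose[OF _ continuous_map_similarity, unfolded o_def])
  have "continuous_map (hausdorff_topology i) euclidean (circumcenter :: (real^'n) set \<Rightarrow> _)"
    "continuous_map (hausdorff_topology i) euclideanreal (circumradius :: (real^'n) set \<Rightarrow> _)"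
    unfolding hausdorff_topology_def
    by (intro continuous_map_from_subtopology continuous_map_circumcenter continuous_map_circumradius)+
  then have "continuous_map (hausdorff_topology i) (prod_topology euclidean (prod_topology euclidean euclidean))
      (\<lambda>K :: (real^'n) set. (circumcenter K, circumradius K, mat 1 :: real^'n^'n))"
    by (intro continuous_map_pairedI) auto
  then show "continuous_map (hausdorff_topology i) (top_of_set similarity_params)
      (\<lambda>K :: (real^'n) set. (circumcenter K, circumradius K, mat 1))"
    using frame_params_in[OF assms] by (auto simp: continuous_map_in_subtopology)
qed

definition shape :: "(real^'n) set \<Rightarrow> (real^'n) set"
  where "shape K = similarity_inv (frame K) ` K"

lemma frame_image_shape:
  "1 \<le> i \<Longrightarrow> K \<in> compact_convex_dim_ge i \<Longrightarrow> frame K ` shape K = K"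
  unfolding shape_def using frame_in by (metis similarity_inv_image(1))

lemma shape_in:
  "1 \<le> i \<Longrightarrow> K \<in> compact_convex_dim_ge i \<Longrightarrow> shape K \<in> compact_convex_dim_ge i"
  unfolding shape_def by (intro similarity_image_in similarity_inv_in frame_in)

lemma dim_ge_imp_in: "K \<in> compact_convex_dim_ge i \<Longrightarrow> K \<in> compact_convex_sets"
  by (simp add: compact_convex_dim_ge_def)

lemma shape_similarity_image:
  assumes i: "1 \<le> i" and K: "K \<in> compact_convex_dim_ge i" and p: "(u, r, A) \<in> similarity_params"
  shows "shape (similarity (u, r, A) ` K) = rotation A ` shape K"
proof -
  let ?g = "similarity (u, r, A)"
  have gK: "?g ` K \<in> compact_convex_dim_ge i"
    using p by (intro similarity_image_in K) (simp add: carrier_similarity_group)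
  have "frame (?g ` K) ` rotation A ` shape K = ?g ` frame K ` shape K"
    using frame_similarity_image[OF dim_ge_imp_in[OF K] p] by (simp only: image_comp)
  also have "\<dots> = ?g ` K"
    by (simp only: frame_image_shape[OF i K])
  finally have "similarity_inv (frame (?g ` K)) ` frame (?g ` K) ` rotation A ` shape K = shape (?g ` K)"
    by (simp only: shape_def)
  then show ?thesis
    by (simp only: similarity_inv_image(2)[OF frame_in[OF i gK]])
qed

lemma continuous_map_shape:
  assumes "1 \<le> i"
  shows "continuous_map (hausdorff_topology i) hyperspace (shape :: (real^'n) set \<Rightarrow> _)"
proof -
  let ?X = "hausdorff_topology i :: (real^'n) set topology"
  interpret G: G_space "similarity_group :: (real^'n \<Rightarrow> real^'n) monoid" similarity_topology
    "hausdorff_topology i" "image_action i"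
    by (rule G_space_compact_convex_sets)
  have "continuous_map ?X (prod_topology similarity_topology ?X) (\<lambda>K. (similarity_inv (frame K), K))"
    using continuous_map_compose[OF continuous_map_frame[OF assms] G.continuous_inv]
    by (intro continuous_map_pairedI) (auto simp: o_def)
  from continuous_map_compose[OF this G.continuous_action]
  have "continuous_map ?X ?X shape"
    by (rule continuous_map_eq) (simp add: image_action_def shape_def)
  then show ?thesis
    by (simp add: hausdorff_topology_def continuous_map_in_subtopology)
qed

section \<open>The finite extension property\<close>

text \<open>Disjointness of orbits identifies the indices, and then the two similarities differ by an element of the
  stabilizer of \<open>x l\<close>, which fixes \<open>y l\<close>.\<close>

lemma orbit_map_well_defined:
  assumes x: "\<And>l. l \<in> L \<Longrightarrow> x l \<in> compact_convex_dim_ge i" "\<And>l. l \<in> L \<Longrightarrow> y l \<in> compact_convex_dim_ge m"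
    and stab: "\<And>l. l \<in> L \<Longrightarrow>
      stabilizer similarity_group (image_action i) (x l) \<subseteq> stabilizer similarity_group (image_action m) (y l)"
    and orb: "\<And>l j. l \<in> L \<Longrightarrow> j \<in> L \<Longrightarrow> l \<noteq> j \<Longrightarrow>
      orbit similarity_group (image_action i) (x l) \<inter> orbit similarity_group (image_action i) (x j) = {}"
    and l: "l \<in> L" "j \<in> L" and g: "g \<in> carrier similarity_group" "h \<in> carrier similarity_group"
    and eq: "g ` x l = h ` x j"
  shows "g ` y l = h ` y j"
proof -
  have "h ` x j \<in> orbit similarity_group (image_action i) (x j)"
    using g(2) x(1)[OF l(2)] by (auto simp: orbit_def image_action_def)
  moreover have "g ` x l \<in> orbit similarity_group (image_action i) (x l)"
    using g(1) x(1)[OF l(1)] by (auto simp: orbit_def image_action_def)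
  ultimately have "g ` x l \<in> orbit similarity_group (image_action i) (x l) \<inter> orbit similarity_group (image_action i) (x j)"
    using eq by simp
  then have j: "j = l"
    using orb[OF l] by auto
  let ?s = "similarity_inv h \<circ> g"
  have s: "?s \<in> carrier similarity_group"
    by (intro similarity_comp_in similarity_inv_in g)
  have "?s ` x l = x l"
  proof -
    have "?s ` x l = similarity_inv h ` h ` x l"
      using eq j by (simp only: image_comp[symmetric])
    then show ?thesis
      by (simp only: similarity_inv_image(2)[OF g(2)])
  qed
  then have "?s \<in> stabilizer similarity_group (image_action i) (x l)"
    using s x(1)[OF l(1)] by (simp add: stabilizer_def image_action_def)
  then have "?s \<in> stabilizer similarity_group (image_action m) (y l)"
    by (rule subsetD[OF stab[OF l(1)]])
  then have "?s ` y l = y l"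
    using x(2)[OF l(1)] by (simp only: stabilizer_def mem_Collect_eq image_action_def restrict_apply' refl)
  then have "h ` similarity_inv h ` g ` y l = h ` y l"
    by (simp only: image_comp)
  then show ?thesis
    using j by (simp only: similarity_inv_image(1)[OF g(2)])
qed

text \<open>
  The shape of \<open>x l\<close> must be sent to the set that the frame of \<open>x l\<close> maps to \<open>y l\<close>, and the rotated
  shapes to the correspondingly rotated sets. These pairs form the graph \<open>P\<close>, a finite union of
  continuous images of the orthogonal group, to which the extension theorem applies.
\<close>

lemma G_map_interpolating_finite_family:
  fixes x y :: "'l \<Rightarrow> (real^'n) set"
  assumes i: "1 \<le> i" and m: "m \<le> CARD('n)" and L: "finite L" "L \<noteq> {}"
    and x: "\<And>l. l \<in> L \<Longrightarrow> x l \<in> compact_convex_dim_ge i"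
    and y: "\<And>l. l \<in> L \<Longrightarrow> y l \<in> compact_convex_dim_ge m"
    and stab: "\<And>l. l \<in> L \<Longrightarrow>
      stabilizer similarity_group (image_action i) (x l) \<subseteq> stabilizer similarity_group (image_action m) (y l)"
    and orb: "\<And>l j. l \<in> L \<Longrightarrow> j \<in> L \<Longrightarrow> l \<noteq> j \<Longrightarrow>
      orbit similarity_group (image_action i) (x l) \<inter> orbit similarity_group (image_action i) (x j) = {}"
  shows "\<exists>f. G_map (similarity_group :: (real^'n \<Rightarrow> real^'n) monoid) (hausdorff_topology i) (image_action i)
    (hausdorff_topology m) (image_action m) f \<and> (\<forall>l\<in>L. f (x l) = y l)"
proof -
  let ?O = "{A :: real^'n^'n. orthogonal_matrix A}"
  let ?X = "hausdorff_topology i :: (real^'n) set topology"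
  let ?Y = "hausdorff_topology m :: (real^'n) set topology"
  define u where "u l A = rotation A \<circ> similarity_inv (frame (x l))" for l A
  have u: "u l A \<in> carrier similarity_group" if "l \<in> L" "A \<in> ?O" for l A
    unfolding u_def using that i x by (intro similarity_comp_in rotation_in similarity_inv_in frame_in) auto
  define graph_piece where "graph_piece l A = (u l A ` x l, u l A ` y l)" for l A
  define P where "P = (\<Union>l\<in>L. graph_piece l ` ?O)"
  have one: "mat 1 \<in> ?O"
    by (simp add: orthogonal_matrix_id)
  have "compactin (prod_topology hyperspace hyperspace) (graph_piece l ` ?O)" if l: "l \<in> L" for l
  proof (rule image_compactin)
    show "compactin (top_of_set ?O) ?O"
      using compact_orthogonal_matrices by (simp add: compactin_subtopology)
    have "similarity_inv (frame (x l)) ` K \<in> compact_convex_sets" if "K \<in> compact_convex_dim_ge j" for K j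
      using similarity_image_in[OF similarity_inv_in[OF frame_in[OF i x[OF l]]] that] by (rule dim_ge_imp_in)
    then show "continuous_map (top_of_set ?O) (prod_topology hyperspace hyperspace) (graph_piece l)"
      unfolding graph_piece_def u_def image_comp[symmetric]
      using x[OF l] y[OF l] by (intro continuous_map_pairedI continuous_map_rotation_image) blast+
  qed
  then have P_compact: "compactin (prod_topology hyperspace hyperspace) P"
    unfolding P_def using L by (intro compactin_Union) auto
  have P_ne: "P \<noteq> {}"
    using L one by (auto simp: P_def)
  have P_single: "B = B'" if "(A, B) \<in> P" "(A, B') \<in> P" for A B B'
  proof -
    obtain l C where l: "l \<in> L" "C \<in> ?O" "A = u l C ` x l" "B = u l C ` y l"
      using \<open>(A, B) \<in> P\<close> by (auto simp: P_def graph_piece_def)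
    obtain j D where j: "j \<in> L" "D \<in> ?O" "A = u j D ` x j" "B' = u j D ` y j"
      using \<open>(A, B') \<in> P\<close> by (auto simp: P_def graph_piece_def)
    have "u l C ` y l = u j D ` y j"
      by (rule orbit_map_well_defined[of L x i y m, OF x y stab orb l(1) j(1)
            u[OF l(1,2)] u[OF j(1,2)]]) (use l j in auto)
    then show ?thesis
      using l j by simp
  qed
  have P_rotation: "map_prod ((`) (rotation A)) ((`) (rotation A)) ` P = P" if A: "A \<in> ?O" for A
  proof -
    have "u l (A ** B) = rotation A \<circ> u l B" for l B
      by (simp add: u_def o_assoc rotation_comp)
    then have "map_prod ((`) (rotation A)) ((`) (rotation A)) (graph_piece l B) = graph_piece l (A ** B)" for l B
      by (simp only: graph_piece_def map_prod_simp image_comp)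
    then have "map_prod ((`) (rotation A)) ((`) (rotation A)) ` P = (\<Union>l\<in>L. graph_piece l ` (**) A ` ?O)"
      unfolding P_def by (auto simp: image_UN image_image)
    moreover have "(**) A ` ?O = ?O"
    proof
      show "(**) A ` ?O \<subseteq> ?O"
        using A by (auto intro: orthogonal_matrix_mul)
      show "?O \<subseteq> (**) A ` ?O"
      proof
        fix B assume B: "B \<in> ?O"
        have "B = A ** (transpose A ** B)"
          using A by (simp add: matrix_mul_assoc orthogonal_matrix_def)
        moreover have "transpose A ** B \<in> ?O"
          using A B by (simp add: orthogonal_matrix_mul)
        ultimately show "B \<in> (**) A ` ?O"
          by blast
      qed
    qed
    ultimately show ?thesis
      by (simp add: P_def)
  qed
  obtain F where F_cont: "continuous_map hyperspace hyperspace F"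
    and F_P: "\<And>A B. (A, B) \<in> P \<Longrightarrow> F A = B"
    and F_dim: "\<And>A. A \<in> compact_convex_sets \<Longrightarrow> F A \<in> snd ` P \<or> interior (F A) \<noteq> {}"
    and F_equiv: "\<And>h A. orthogonal_transformation h \<Longrightarrow> map_prod ((`) h) ((`) h) ` P = P \<Longrightarrow>
      A \<in> compact_convex_sets \<Longrightarrow> F (h ` A) = h ` F A"
    by (rule equivariant_extension_of_compact_graph[OF P_compact P_ne P_single]) blast+
  have F_in: "F A \<in> compact_convex_dim_ge m" if A: "A \<in> compact_convex_sets" for A
  proof -
    have "F A \<in> compact_convex_sets"
      using continuous_map_image_subset_topspace[OF F_cont] A by auto
    moreover have "interior (F A) = {} \<or> aff_dim (F A) = CARD('n)"
      using aff_dim_nonempty_interior[of "F A"] by auto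
    moreover have "B \<in> compact_convex_dim_ge m" if "B \<in> snd ` P" for B
      using that u y by (auto simp: P_def graph_piece_def intro!: similarity_image_in)
    ultimately show ?thesis
      using F_dim[OF A] m by (auto simp: compact_convex_dim_ge_def)
  qed
  interpret Y: G_space "similarity_group :: (real^'n \<Rightarrow> real^'n) monoid" similarity_topology ?Y "image_action m"
    by (rule G_space_compact_convex_sets)
  define f where "f K = frame K ` F (shape K)" for K
  have F_shape: "F (shape K) \<in> compact_convex_dim_ge m" if "K \<in> compact_convex_dim_ge i" for K
    by (intro F_in dim_ge_imp_in[OF shape_in[OF i that]])
  have "continuous_map ?X hyperspace (\<lambda>K. F (shape K))"
    using continuous_map_compose[OF continuous_map_shape[OF i] F_cont] by (simp add: o_def)
  then have "continuous_map ?X ?Y (\<lambda>K. F (shape K))"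
    using F_shape by (auto simp: hausdorff_topology_def[of m] continuous_map_in_subtopology)
  from continuous_map_compose[OF continuous_map_pairedI[OF continuous_map_frame[OF i] this] Y.continuous_action]
  have "continuous_map ?X ?Y f"
    by (rule continuous_map_eq) (use F_shape in \<open>simp add: f_def image_action_def\<close>)
  moreover have "f (image_action i g K) = image_action m g (f K)"
    if g: "g \<in> carrier similarity_group" and K: "K \<in> compact_convex_dim_ge i" for g K
  proof -
    obtain v r A where p: "(v, r, A) \<in> similarity_params" and g_eq: "g = similarity (v, r, A)"
      using g by (auto simp: carrier_similarity_group)
    then have A: "A \<in> ?O"
      by (simp add: similarity_params_def)
    have fK: "f K \<in> compact_convex_dim_ge m"
      unfolding f_def by (intro similarity_image_in frame_in[OF i K] F_shape[OF K])
    have "f (g ` K) = frame (g ` K) ` F (rotation A ` shape K)"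
      unfolding f_def g_eq shape_similarity_image[OF i K p] ..
    also have "F (rotation A ` shape K) = rotation A ` F (shape K)"
      using A by (intro F_equiv orthogonal_transformation_rotation P_rotation dim_ge_imp_in[OF shape_in[OF i K]]) auto
    also have "frame (g ` K) ` rotation A ` F (shape K) = g ` f K"
      unfolding f_def g_eq image_comp frame_similarity_image[OF dim_ge_imp_in[OF K] p] ..
    finally show ?thesis
      using K fK by (simp add: image_action_def)
  qed
  moreover have "f (x l) = y l" if l: "l \<in> L" for l
  proof -
    have "u l (mat 1) = similarity_inv (frame (x l))"
      by (simp add: u_def similarity_one)
    then have "(shape (x l), similarity_inv (frame (x l)) ` y l) = graph_piece l (mat 1)"
      by (simp add: graph_piece_def shape_def)
    then have "F (shape (x l)) = similarity_inv (frame (x l)) ` y l"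
      using l one by (intro F_P) (auto simp: P_def)
    then show ?thesis
      by (simp only: f_def similarity_inv_image(1)[OF frame_in[OF i x[OF l]]])
  qed
  ultimately show ?thesis
    by (auto simp: G_map_def)
qed

lemma unit_ball_in:
  assumes "j \<le> CARD('n)"
  shows "(cball 0 1 :: (real^'n) set) \<in> compact_convex_dim_ge j"
  using assms by (simp add: compact_convex_dim_ge_def compact_convex_sets_def aff_dim_cball)

theorem theorem4p8:
  fixes i m :: nat
  assumes "1 \<le> i" and "i \<le> CARD('n::finite)" and "m \<le> CARD('n)"
  shows "finite_extension_property
    (similarity_group :: (real^'n \<Rightarrow> real^'n) monoid) similarity_topology
    (hausdorff_topology i) (image_action i)
    (hausdorff_topology m) (image_action m)"
  unfolding finite_extension_property_def
proof (intro conjI allI impI)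
  fix k :: nat and x y :: "nat \<Rightarrow> (real^'n) set"
  let ?G = "similarity_group :: (real^'n \<Rightarrow> real^'n) monoid"
  assume *: "\<forall>l\<in>{1..k}. x l \<in> topspace (hausdorff_topology i) \<and> y l \<in> topspace (hausdorff_topology m)"
    "\<forall>l\<in>{1..k}. stabilizer ?G (image_action i) (x l) \<subseteq> stabilizer ?G (image_action m) (y l)"
    "\<forall>l\<in>{1..k}. \<forall>j\<in>{1..k}. l \<noteq> j \<longrightarrow>
      orbit ?G (image_action i) (x l) \<inter> orbit ?G (image_action i) (x j) = {}"
  show "\<exists>f. G_map ?G (hausdorff_topology i) (image_action i) (hausdorff_topology m) (image_action m) f \<and>
      (\<forall>l\<in>{1..k}. f (x l) = y l)"
  proof (cases "k = 0")
    case False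
    then show ?thesis
      using * by (intro G_map_interpolating_finite_family assms) auto
  next
    case True
    \<comment> \<open>Some \<open>G\<close>-map is still required; the unit ball, which lies in both spaces, provides a
      one-element family.\<close>
    let ?B = "cball 0 1 :: (real^'n) set"
    have "stabilizer ?G (image_action i) ?B \<subseteq> stabilizer ?G (image_action m) ?B"
      using unit_ball_in[OF assms(2)] unit_ball_in[OF assms(3)]
      by (auto simp: stabilizer_def image_action_def)
    then have "\<exists>f. G_map ?G (hausdorff_topology i) (image_action i) (hausdorff_topology m) (image_action m) f \<and>
        (\<forall>l\<in>{()}. f ?B = ?B)"
      using unit_ball_in[OF assms(2)] unit_ball_in[OF assms(3)]
      by (intro G_map_interpolating_finite_family assms) auto
    then show ?thesis
      using True by auto
  qed
qed (rule G_space_compact_convex_sets)+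

end
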